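(* Let $Y$ be a Banach space and let $\{X_n\}_{n\in\mathbb{N}}$ and $X$ be closed subspaces of $Y$ with $X_n\to X$ in the gap topology, i.e. $\lim_{n\to\infty}Q(X_n,X)=0$. Then: (i) for every free ultrafilter $\mathcal{U}$ on $\mathbb{N}$, $$n(X_{\mathcal{U}})\le\lim_{\mathcal{U}} n(X_n);$$ (ii) if $n(X_{\mathcal{U}})=n(X)$ for every free ultrafilter $\mathcal{U}$ on $\mathbb{N}$, then $$n(X)\le\liminf_{n\to\infty} n(X_n).$$
   Context: Banach spaces are over $\mathbb{K}$ ($\mathbb{R}$ or $\mathbb{C}$). For a Banach space $E$, $\mathcal{L}(E)$ denotes the bounded linear operators on $E$, $S_E$ the unit sphere, $E^*$ the dual space. Numerical radius and index: for $T\in\mathcal{L}(E)$, $$v(T)=\sup\{|x^*(Tx)| : x\in S_E,\ x^*\in S_{E^*},\ x^*(x)=1\},$$ and $n(E)=\inf\{v(T): T\in\mathcal{L}(E),\ \|T\|=1\}$. Gap topology: for closed subspaces $W,Z$ of $Y$, the geometric (gap) opening is $$Q(W,Z)=\max\Big\{\sup_{w\in S_W}\mathrm{dist}(w,S_Z),\ \sup_{z\in S_Z}\mathrm{dist}(z,S_W)\Big\},$$ where $\mathrm{dist}(x,A)=\inf_{a\in A}\|x-a\|$. Convergence $X_n\to X$ in the gap topology means $Q(X_n,X)\to0$. Ultrapower: for a Banach space $X$ and a free (non-principal) ultrafilter $\mathcal{U}$ on $\mathbb{N}$, $X_{\mathcal{U}}=\ell_\infty(X)/\{(x_n)\in\ell_\infty(X):\lim_{\mathcal{U}}\|x_n\|=0\}$,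 where $\ell_\infty(X)$ is the space of bounded sequences in $X$; the norm of the class $(x_n)_{\mathcal{U}}$ is $\lim_{\mathcal{U}}\|x_n\|$. Here $\lim_{\mathcal{U}}$ denotes the limit of a bounded scalar sequence along $\mathcal{U}$. *)

theory Defs
  imports "HOL-Analysis.Analysis"
begin

text \<open>
  A type of this class is a copy of the real or of the complex field: \<open>to_complex\<close> is an isometric
  field embedding into the complex numbers whose range is either the reals or everything.
\<close>

class real_or_complex = real_normed_field +
  fixes to_complex :: "'a \<Rightarrow> complex"
  assumes to_complex_add: "to_complex (a + b) = to_complex a + to_complex b"
    and to_complex_mult: "to_complex (a * b) = to_complex a * to_complex b"
    and to_complex_scaleR: "to_complex (r *\<^sub>R a) = r *\<^sub>R to_complex a"
    and norm_to_complex: "norm (to_complex a) = norm a"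
    and range_to_complex: "range to_complex = \<real> \<or> range to_complex = UNIV"

instantiation real :: real_or_complex
begin

definition to_complex_real :: "real \<Rightarrow> complex"
  where "to_complex_real = of_real"

instance
proof
  show "range (to_complex :: real \<Rightarrow> complex) = \<real> \<or> range (to_complex :: real \<Rightarrow> complex) = UNIV"
    by (rule disjI1) (simp only: to_complex_real_def Reals_def)
qed (simp_all add: to_complex_real_def scaleR_conv_of_real)

end

instantiation complex :: real_or_complex
begin

definition to_complex_complex :: "complex \<Rightarrow> complex"
  where "to_complex_complex = id"

instance
  by standard (auto simp: to_complex_complex_def)

end

text \<open>
  Subspaces, ultrapowers and the scalar field itself are all presented in this form, so that
  operators, duals and the numerical index are defined once for all of them. Maps are total
  functions of which only the values on the carrier matter.
\<close>

record ('k, 'a) nspace =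
  vcarrier :: "'a set"
  vzero :: 'a
  vadd :: "'a \<Rightarrow> 'a \<Rightarrow> 'a"
  vscale :: "'k \<Rightarrow> 'a \<Rightarrow> 'a"
  vnorm :: "'a \<Rightarrow> real"

definition unit_sphere :: "('k, 'a) nspace \<Rightarrow> 'a set"
  where "unit_sphere E = {x \<in> vcarrier E. vnorm E x = 1}"

definition bounded_operators :: "('k, 'a) nspace \<Rightarrow> ('k, 'b) nspace \<Rightarrow> ('a \<Rightarrow> 'b) set"
  where "bounded_operators E F =
    {T. (\<forall>x\<in>vcarrier E. T x \<in> vcarrier F) \<and>
        (\<forall>x\<in>vcarrier E. \<forall>y\<in>vcarrier E. T (vadd E x y) = vadd F (T x) (T y)) \<and>
        (\<forall>c. \<forall>x\<in>vcarrier E. T (vscale E c x) = vscale F c (T x)) \<and>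
        (\<exists>B. \<forall>x\<in>vcarrier E. vnorm F (T x) \<le> B * vnorm E x)}"

definition operator_norm :: "('k, 'a) nspace \<Rightarrow> ('k, 'b) nspace \<Rightarrow> ('a \<Rightarrow> 'b) \<Rightarrow> ennreal"
  where "operator_norm E F T = (SUP x\<in>{x \<in> vcarrier E. vnorm E x \<le> 1}. ennreal (vnorm F (T x)))"

definition scalar_space :: "('k::real_or_complex, 'k) nspace"
  where "scalar_space =
    \<lparr>vcarrier = UNIV, vzero = 0, vadd = (+), vscale = (*), vnorm = norm\<rparr>"

definition dual_sphere :: "('k::real_or_complex, 'a) nspace \<Rightarrow> ('a \<Rightarrow> 'k) set"
  where "dual_sphere E =
    {f \<in> bounded_operators E scalar_space. operator_norm E scalar_space f = 1}"

text \<open>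
  Suprema and infima are taken in \<open>[0, \<infinity>]\<close>. On a nonzero space both quantities are finite; on the
  zero space there is no operator of norm 1 and the index is \<open>Inf {} = \<infinity>\<close>.
\<close>

definition numerical_radius :: "('k::real_or_complex, 'a) nspace \<Rightarrow> ('a \<Rightarrow> 'a) \<Rightarrow> ennreal"
  where "numerical_radius E T =
    (SUP (x, f)\<in>{(x, f). x \<in> unit_sphere E \<and> f \<in> dual_sphere E \<and> f x = 1}.
      ennreal (norm (f (T x))))"

definition numerical_index :: "('k::real_or_complex, 'a) nspace \<Rightarrow> ennreal"
  where "numerical_index E =
    (INF T\<in>{T \<in> bounded_operators E E. operator_norm E E T = 1}. numerical_radius E T)"

locale banach_space_over = vector_space smul
  for smul :: "'k::real_or_complex \<Rightarrow> 'a::banach \<Rightarrow> 'a" +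
  assumes norm_scale: "norm (smul c x) = norm c * norm x"
    and scale_of_real: "smul (of_real r) x = r *\<^sub>R x"

definition closed_subspace :: "('k::real_or_complex \<Rightarrow> 'a::banach \<Rightarrow> 'a) \<Rightarrow> 'a set \<Rightarrow> bool"
  where "closed_subspace smul X \<longleftrightarrow> module.subspace smul X \<and> closed X"

definition subspace_nspace ::
    "('k::real_or_complex \<Rightarrow> 'a::banach \<Rightarrow> 'a) \<Rightarrow> 'a set \<Rightarrow> ('k, 'a) nspace"
  where "subspace_nspace smul X =
    \<lparr>vcarrier = X, vzero = 0, vadd = (+), vscale = smul, vnorm = norm\<rparr>"

text \<open>
  The library's \<open>infdist\<close> is 0 for the empty set; here the distance to the empty set is \<open>\<infinity>\<close>,
  which matters when one of the subspaces is zero and its unit sphere is empty.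
\<close>

definition set_dist :: "'a::metric_space \<Rightarrow> 'a set \<Rightarrow> ennreal"
  where "set_dist x A = (INF a\<in>A. ennreal (dist x a))"

definition gap :: "'a::real_normed_vector set \<Rightarrow> 'a set \<Rightarrow> ennreal"
  where "gap W Z =
    max (SUP w\<in>W \<inter> sphere 0 1. set_dist w (Z \<inter> sphere 0 1))
        (SUP z\<in>Z \<inter> sphere 0 1. set_dist z (W \<inter> sphere 0 1))"

definition free_ultrafilter :: "'i filter \<Rightarrow> bool"
  where "free_ultrafilter U \<longleftrightarrow>
    U \<noteq> bot \<and>
    (\<forall>P. eventually P U \<or> eventually (\<lambda>n. \<not> P n) U) \<and>
    (\<forall>m. \<not> eventually (\<lambda>n. n = m) U)"

lemma free_ultrafilter_tendsto_Lim:
  fixes f :: "'i \<Rightarrow> 'b::t2_space"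
  assumes U: "free_ultrafilter U" and K: "compact K" and f: "\<And>n. f n \<in> K"
  shows "(f \<longlongrightarrow> Lim U f) U"
proof -
  have ne: "U \<noteq> bot" and ultra: "\<And>P. eventually P U \<or> eventually (\<lambda>n. \<not> P n) U"
    using U by (auto simp: free_ultrafilter_def)
  have "filtermap f U \<noteq> bot" "eventually (\<lambda>x. x \<in> K) (filtermap f U)"
    using ne f by (auto simp: filtermap_bot_iff eventually_filtermap)
  then obtain l where l: "inf (nhds l) (filtermap f U) \<noteq> bot"
    using K unfolding compact_filter by blast
  have "(f \<longlongrightarrow> l) U"
  proof (rule topological_tendstoI)
    fix S assume S: "open S" "l \<in> S"
    show "eventually (\<lambda>n. f n \<in> S) U"
    proof (rule ccontr)
      assume "\<not> eventually (\<lambda>n. f n \<in> S) U"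
      then have "eventually (\<lambda>n. f n \<notin> S) U"
        using ultra by blast
      then have "eventually (\<lambda>x. False) (inf (nhds l) (filtermap f U))"
        unfolding eventually_inf eventually_filtermap
        using eventually_nhds_in_open[OF S]
        by (intro exI[of _ "\<lambda>x. x \<in> S"] exI[of _ "\<lambda>x. x \<notin> S"]) auto
      with l show False by (simp add: eventually_False)
    qed
  qed
  with tendsto_Lim[OF ne this] show ?thesis by simp
qed

lemma free_ultrafilter_tendsto_Lim_ennreal:
  fixes f :: "'i \<Rightarrow> ennreal"
  assumes "free_ultrafilter U"
  shows "(f \<longlongrightarrow> Lim U f) U"
  by (rule free_ultrafilter_tendsto_Lim[OF assms compact_UNIV]) simp

definition bounded_sequences :: "'a::real_normed_vector set \<Rightarrow> (nat \<Rightarrow> 'a) set"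
  where "bounded_sequences X = {x. range x \<subseteq> X \<and> bounded (range x)}"

definition ultra_rel :: "'a::real_normed_vector set \<Rightarrow> nat filter \<Rightarrow> ((nat \<Rightarrow> 'a) \<times> (nat \<Rightarrow> 'a)) set"
  where "ultra_rel X U =
    {(x, y). x \<in> bounded_sequences X \<and> y \<in> bounded_sequences X \<and>
             ((\<lambda>n. norm (x n - y n)) \<longlongrightarrow> 0) U}"

definition ultrapower ::
    "('k::real_or_complex \<Rightarrow> 'a::banach \<Rightarrow> 'a) \<Rightarrow> 'a set \<Rightarrow> nat filter \<Rightarrow> ('k, (nat \<Rightarrow> 'a) set) nspace"
  where "ultrapower smul X U =
    \<lparr>vcarrier = bounded_sequences X // ultra_rel X U,
     vzero = ultra_rel X U `` {\<lambda>n. 0},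
     vadd = (\<lambda>C D. \<Union>x\<in>C. \<Union>y\<in>D. ultra_rel X U `` {\<lambda>n. x n + y n}),
     vscale = (\<lambda>c C. \<Union>x\<in>C. ultra_rel X U `` {\<lambda>n. smul c (x n)}),
     vnorm = (\<lambda>C. the_elem ((\<lambda>x. Lim U (\<lambda>n. norm (x n))) ` C))\<rparr>"

text \<open>The operations and the norm of the ultrapower are computed on arbitrary representatives.\<close>

lemma equiv_ultra_rel: "equiv (bounded_sequences X) (ultra_rel X U)"
proof (rule equivI)
  show "ultra_rel X U \<subseteq> bounded_sequences X \<times> bounded_sequences X"
    by (auto simp: ultra_rel_def)
  show "refl_on (bounded_sequences X) (ultra_rel X U)"
    by (auto simp: refl_on_def ultra_rel_def)
  show "sym (ultra_rel X U)"
    by (auto simp: sym_def ultra_rel_def norm_minus_commute)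
  show "trans (ultra_rel X U)"
  proof (rule transI)
    fix x y z assume xy: "(x, y) \<in> ultra_rel X U" and yz: "(y, z) \<in> ultra_rel X U"
    have "((\<lambda>n. norm (x n - y n) + norm (y n - z n)) \<longlongrightarrow> 0) U"
      using tendsto_add[of "\<lambda>n. norm (x n - y n)" 0 U "\<lambda>n. norm (y n - z n)" 0] xy yz
      by (auto simp: ultra_rel_def)
    then have "((\<lambda>n. norm (x n - z n)) \<longlongrightarrow> 0) U"
    proof (rule Lim_null_comparison[rotated])
      show "eventually (\<lambda>n. norm (norm (x n - z n)) \<le> norm (x n - y n) + norm (y n - z n)) U"
      proof (rule always_eventually, rule allI)
        show "norm (norm (x n - z n)) \<le> norm (x n - y n) + norm (y n - z n)" for n
          using norm_triangle_ineq[of "x n - y n" "y n - z n"] by simp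
      qed
    qed
    then show "(x, z) \<in> ultra_rel X U"
      using xy yz by (auto simp: ultra_rel_def)
  qed
qed

lemma tendsto_norm_bounded_sequence:
  assumes U: "free_ultrafilter U" and x: "x \<in> bounded_sequences X"
  shows "((\<lambda>n. norm (x n)) \<longlongrightarrow> Lim U (\<lambda>n. norm (x n))) U"
proof -
  from x obtain B where "\<And>n. norm (x n) \<le> B"
    by (auto simp: bounded_sequences_def bounded_iff)
  then show ?thesis
    by (intro free_ultrafilter_tendsto_Lim[OF U compact_Icc[of 0 B]]) auto
qed

lemma vnorm_ultrapower:
  assumes U: "free_ultrafilter U" and x: "x \<in> bounded_sequences X"
  shows "vnorm (ultrapower smul X U) (ultra_rel X U `` {x}) = Lim U (\<lambda>n. norm (x n))"
proof -
  have ne: "U \<noteq> bot" using U by (simp add: free_ultrafilter_def)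
  have eq: "Lim U (\<lambda>n. norm (y n)) = Lim U (\<lambda>n. norm (x n))" if "(x, y) \<in> ultra_rel X U" for y
  proof (rule tendsto_Lim[OF ne])
    have "((\<lambda>n. norm (y n) - norm (x n)) \<longlongrightarrow> 0) U"
    proof (rule Lim_null_comparison)
      show "((\<lambda>n. norm (x n - y n)) \<longlongrightarrow> 0) U"
        using that by (simp add: ultra_rel_def)
      show "eventually (\<lambda>n. norm (norm (y n) - norm (x n)) \<le> norm (x n - y n)) U"
      proof (rule always_eventually, rule allI)
        show "norm (norm (y n) - norm (x n)) \<le> norm (x n - y n)" for n
          using norm_triangle_ineq3[of "y n" "x n"] by (simp add: norm_minus_commute)
      qed
    qed
    from tendsto_add[OF this tendsto_norm_bounded_sequence[OF U x]]
    show "((\<lambda>n. norm (y n)) \<longlongrightarrow> Lim U (\<lambda>n. norm (x n))) U" by simp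
  qed
  have "(\<lambda>x. Lim U (\<lambda>n. norm (x n))) ` (ultra_rel X U `` {x}) =
      (\<lambda>_. Lim U (\<lambda>n. norm (x n))) ` (ultra_rel X U `` {x})"
    by (intro image_cong refl eq) simp
  also have "\<dots> = {Lim U (\<lambda>n. norm (x n))}"
    using equiv_class_self[OF equiv_ultra_rel x] by (metis empty_iff image_constant)
  finally show ?thesis by (simp add: ultrapower_def)
qed

lemma vadd_ultrapower:
  assumes "banach_space_over smul" and "closed_subspace smul X"
    and x: "x \<in> bounded_sequences X" and y: "y \<in> bounded_sequences X"
  shows "vadd (ultrapower smul X U) (ultra_rel X U `` {x}) (ultra_rel X U `` {y}) =
    ultra_rel X U `` {\<lambda>n. x n + y n}"
proof -
  interpret banach_space_over smul by fact
  have closed_add: "(\<lambda>n. u n + v n) \<in> bounded_sequences X"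
    if "u \<in> bounded_sequences X" "v \<in> bounded_sequences X" for u v
    using assms(2) that
    by (auto simp: closed_subspace_def subspace_def bounded_sequences_def intro: bounded_plus_comp)
  have eq: "ultra_rel X U `` {\<lambda>n. u n + v n} = ultra_rel X U `` {\<lambda>n. x n + y n}"
    if u: "(x, u) \<in> ultra_rel X U" and v: "(y, v) \<in> ultra_rel X U" for u v
  proof (rule equiv_class_eq[OF equiv_ultra_rel, symmetric])
    have "((\<lambda>n. (x n - u n) + (y n - v n)) \<longlongrightarrow> 0) U"
      using tendsto_add[of "\<lambda>n. x n - u n" 0 U "\<lambda>n. y n - v n" 0] u v
      by (simp add: ultra_rel_def tendsto_norm_zero_iff)
    then have "((\<lambda>n. norm ((x n + y n) - (u n + v n))) \<longlongrightarrow> 0) U"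
      by (simp add: tendsto_norm_zero_iff add_diff_add)
    then show "(\<lambda>n. x n + y n, \<lambda>n. u n + v n) \<in> ultra_rel X U"
      using u v closed_add by (simp add: ultra_rel_def)
  qed
  have "ultra_rel X U `` {x} \<noteq> {}" "ultra_rel X U `` {y} \<noteq> {}"
    using x y by (auto dest: equiv_class_self[OF equiv_ultra_rel])
  then have "(\<Union>u\<in>ultra_rel X U `` {x}. \<Union>v\<in>ultra_rel X U `` {y}. ultra_rel X U `` {\<lambda>n. u n + v n}) =
      ultra_rel X U `` {\<lambda>n. x n + y n}"
    by (intro SUP_eq_const eq) simp_all
  then show ?thesis by (simp add: ultrapower_def)
qed

lemma vscale_ultrapower:
  assumes "banach_space_over smul" and "closed_subspace smul X"
    and x: "x \<in> bounded_sequences X"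
  shows "vscale (ultrapower smul X U) c (ultra_rel X U `` {x}) =
    ultra_rel X U `` {\<lambda>n. smul c (x n)}"
proof -
  interpret banach_space_over smul by fact
  have closed_scale: "(\<lambda>n. smul c (u n)) \<in> bounded_sequences X"
    if u: "u \<in> bounded_sequences X" for u
  proof -
    obtain B where "\<And>n. norm (u n) \<le> B"
      using u by (auto simp: bounded_sequences_def bounded_iff)
    then have "\<And>n. norm (smul c (u n)) \<le> norm c * B"
      by (simp add: norm_scale mult_left_mono)
    then have "bounded (range (\<lambda>n. smul c (u n)))"
      by (auto simp: bounded_iff)
    then show ?thesis
      using assms(2) u by (auto simp: closed_subspace_def subspace_def bounded_sequences_def)
  qed
  have eq: "ultra_rel X U `` {\<lambda>n. smul c (u n)} = ultra_rel X U `` {\<lambda>n. smul c (x n)}"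
    if u: "(x, u) \<in> ultra_rel X U" for u
  proof (rule equiv_class_eq[OF equiv_ultra_rel, symmetric])
    have "((\<lambda>n. norm c * norm (x n - u n)) \<longlongrightarrow> 0) U"
      using tendsto_mult_right_zero[of "\<lambda>n. norm (x n - u n)" U "norm c"] u
      by (simp add: ultra_rel_def)
    then have "((\<lambda>n. norm (smul c (x n) - smul c (u n))) \<longlongrightarrow> 0) U"
      by (simp add: norm_scale flip: scale_right_diff_distrib)
    then show "(\<lambda>n. smul c (x n), \<lambda>n. smul c (u n)) \<in> ultra_rel X U"
      using u closed_scale by (simp add: ultra_rel_def)
  qed
  have "ultra_rel X U `` {x} \<noteq> {}"
    using x by (auto dest: equiv_class_self[OF equiv_ultra_rel])
  then have "(\<Union>u\<in>ultra_rel X U `` {x}. ultra_rel X U `` {\<lambda>n. smul c (u n)}) =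
      ultra_rel X U `` {\<lambda>n. smul c (x n)}"
    by (intro SUP_eq_const eq) simp_all
  then show ?thesis by (simp add: ultrapower_def)
qed

end

theory Submission
  imports Defs
begin

text \<open>
  If \<open>T\<close> is a contraction with numerical radius at most \<open>c\<close>, then evaluating \<open>z - l T z\<close> at a norming
  functional of \<open>z\<close> gives \<open>(1 - \<bar>l\<bar> c) \<parallel>z\<parallel> \<le> \<parallel>z - l T z\<parallel>\<close>, and \<open>z = x + l T x\<close> turns this into
  \<open>(1 - \<bar>l\<bar> c) \<parallel>x + l T x\<parallel> \<le> (1 + \<bar>l\<bar>\<^sup>2) \<parallel>x\<parallel>\<close>. Conversely, letting \<open>l \<rightarrow> 0\<close> in this inequality recovers the
  bound \<open>c\<close> on the numerical radius. The inequality mentions only norms of vectors, so it passes to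
  limits along an ultrafilter, although the dual of the ultrapower is larger than the ultrapower of
  the dual.

  Operators \<open>T\<close> of norm 1 on the \<open>n\<close>-th subspace with numerical radius below \<open>c\<close> are carried to the
  limit space by norm-preserving selections of nearby vectors. The resulting maps are linear only up
  to an error controlled by the gap; since the error vanishes in the limit, they induce an operator
  of norm 1 and numerical radius at most \<open>c\<close> on the ultrapower. The second claim follows by applying
  the first to an ultrafilter containing a set on which the indices stay below a value under the index
  of the limit space.
\<close>

section \<open>Norming functionals\<close>

text \<open>Negative values are allowed, so linear functionals are sublinear and can occur as
  minimal elements.\<close>

definition sublinear :: "('a::real_vector \<Rightarrow> real) \<Rightarrow> bool"
  where "sublinear p \<longleftrightarrow>
    (\<forall>x y. p (x + y) \<le> p x + p y) \<and> (\<forall>t x. 0 \<le> t \<longrightarrow> p (t *\<^sub>R x) = t * p x)"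

lemma sublinear_add: "sublinear p \<Longrightarrow> p (x + y) \<le> p x + p y"
  by (simp add: sublinear_def)

lemma sublinear_scale: "sublinear p \<Longrightarrow> 0 \<le> t \<Longrightarrow> p (t *\<^sub>R x) = t * p x"
  by (simp add: sublinear_def)

lemma sublinear_zero: "sublinear p \<Longrightarrow> p 0 = 0"
  using sublinear_scale[of p 0 0] by simp

lemma sublinear_minus: "sublinear p \<Longrightarrow> - p (- x) \<le> p x"
  using sublinear_add[of p x "- x"] sublinear_zero[of p] by simp

text \<open>The inequality for the factor \<open>1 / t\<close> at the point
  \<open>t *\<^sub>R x\<close> is the reverse of the one for \<open>t\<close>, so one direction
  suffices once the value at 0 is known.\<close>

lemma sublinearI:
  assumes add: "\<And>x y. p (x + y) \<le> p x + p y"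
    and zero: "p 0 = 0"
    and scale: "\<And>t x. 0 < t \<Longrightarrow> p (t *\<^sub>R x) \<le> t * p x"
  shows "sublinear p"
  unfolding sublinear_def
proof (intro conjI allI impI)
  fix t x assume t: "0 \<le> (t::real)"
  show "p (t *\<^sub>R x) = t * p x"
  proof (cases "t = 0")
    case False
    with t have "0 < t" by simp
    have "p x \<le> (1 / t) * p (t *\<^sub>R x)"
      using scale[of "1 / t" "t *\<^sub>R x"] \<open>0 < t\<close> by simp
    then have "t * p x \<le> p (t *\<^sub>R x)"
      using \<open>0 < t\<close> by (simp add: field_simps)
    with scale[OF \<open>0 < t\<close>] show ?thesis by (simp add: order_antisym)
  qed (simp add: zero)
qed (rule add)

lemma sublinear_norm: "sublinear (norm :: 'a::real_normed_vector \<Rightarrow> real)"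
  by (intro sublinearI norm_triangle_ineq) auto

text \<open>The descent is an infimum over the ray from \<open>x\<close> in direction
  \<open>y\<close>. The parameter 0 keeps \<open>q\<close> below \<open>p\<close>; the parameter 1
  gives \<open>q (- y) \<le> - p y\<close>, which forces equality at \<open>y\<close> for every
  linear functional below \<open>q\<close>.\<close>

lemma sublinear_descent:
  assumes p: "sublinear p"
  obtains q where "sublinear q" "\<And>x t. 0 \<le> t \<Longrightarrow> q x \<le> p (x + t *\<^sub>R y) - t * p y"
proof
  define q where "q = (\<lambda>x. INF t\<in>{0..}. p (x + t *\<^sub>R y) - t * p y)"
  have bdd: "bdd_below ((\<lambda>t. p (x + t *\<^sub>R y) - t * p y) ` {0..})" for x
  \<comment> \<open>The bound comes from writing \<open>t *\<^sub>R y\<close> as the sum of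
    \<open>x + t *\<^sub>R y\<close> and \<open>- x\<close>.\<close>
  proof (rule bdd_belowI2[where m = "- p (- x)"])
    fix t :: real assume "t \<in> {0..}"
    then show "- p (- x) \<le> p (x + t *\<^sub>R y) - t * p y"
      using sublinear_add[OF p, of "x + t *\<^sub>R y" "- x"] sublinear_scale[OF p, of t y] by simp
  qed
  show le: "q x \<le> p (x + t *\<^sub>R y) - t * p y" if "0 \<le> t" for x t
    unfolding q_def using that by (intro cINF_lower bdd) auto
  have ge: "m \<le> q x" if "\<And>t. 0 \<le> t \<Longrightarrow> m \<le> p (x + t *\<^sub>R y) - t * p y" for m x
    unfolding q_def using that by (intro cINF_greatest) auto
  show "sublinear q"
  proof (rule sublinearI)
    fix x z
    have "q (x + z) - q x \<le> q z"
    proof (rule ge)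
      fix t :: real assume t: "0 \<le> t"
      have "q (x + z) - (p (z + t *\<^sub>R y) - t * p y) \<le> q x"
      proof (rule ge)
        fix s :: real assume s: "0 \<le> s"
        \<comment> \<open>Parameters \<open>s\<close> for \<open>x\<close> and \<open>t\<close> for
          \<open>z\<close> are matched by the parameter \<open>s + t\<close> for
          \<open>x + z\<close>.\<close>
        have "q (x + z) \<le> p (x + z + (s + t) *\<^sub>R y) - (s + t) * p y"
          using s t by (intro le) simp
        also have "x + z + (s + t) *\<^sub>R y = (x + s *\<^sub>R y) + (z + t *\<^sub>R y)"
          by (simp add: algebra_simps)
        also have "p \<dots> \<le> p (x + s *\<^sub>R y) + p (z + t *\<^sub>R y)"
          by (rule sublinear_add[OF p])
        finally show "q (x + z) - (p (z + t *\<^sub>R y) - t * p y) \<le> p (x + s *\<^sub>R y) - s * p y"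
          by (simp add: algebra_simps)
      qed
      then show "q (x + z) - q x \<le> p (z + t *\<^sub>R y) - t * p y" by simp
    qed
    then show "q (x + z) \<le> q x + q z" by simp
  next
    have "q 0 \<le> 0" using le[of 0 0] by (simp add: sublinear_zero[OF p])
    moreover have "0 \<le> q 0" by (intro ge) (simp add: sublinear_scale[OF p])
    ultimately show "q 0 = 0" by simp
  next
    fix r :: real and x assume r: "0 < r"
    have "q (r *\<^sub>R x) / r \<le> q x"
    proof (rule ge)
      fix t :: real assume t: "0 \<le> t"
      have "q (r *\<^sub>R x) \<le> p (r *\<^sub>R x + (r * t) *\<^sub>R y) - r * t * p y"
        using r t by (intro le) simp
      also have "r *\<^sub>R x + (r * t) *\<^sub>R y = r *\<^sub>R (x + t *\<^sub>R y)"
        by (simp add: algebra_simps)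
      also have "p \<dots> = r * p (x + t *\<^sub>R y)"
        using r by (intro sublinear_scale[OF p]) simp
      finally show "q (r *\<^sub>R x) / r \<le> p (x + t *\<^sub>R y) - t * p y"
        using r by (simp add: field_simps)
    qed
    then show "q (r *\<^sub>R x) \<le> r * q x" using r by (simp add: field_simps)
  qed
qed

text \<open>Zorn's lemma on the sublinear functionals below \<open>p\<close>. A nonempty chain is
  bounded by its pointwise infimum, which is finite because each member is at least
  \<open>- p (- x)\<close> at \<open>x\<close>.\<close>

lemma sublinear_minimal:
  assumes p: "sublinear p"
  obtains m where "sublinear m" "\<And>x. m x \<le> p x"
    "\<And>q. sublinear q \<Longrightarrow> (\<And>x. q x \<le> m x) \<Longrightarrow> q = m"
proof -
  define A where "A = {q. sublinear q \<and> (\<forall>x. q x \<le> p x)}"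
  \<comment> \<open>The order is reversed, so a maximal element for \<open>P\<close> is a minimal
    functional.\<close>
  define P where "P = (\<lambda>a b :: 'a \<Rightarrow> real. \<forall>x. b x \<le> a x)"
  have po: "partial_order_on A (relation_of P A)"
  proof (rule partial_order_on_relation_ofI)
    show "P a c" if "P a b" "P b c" for a b c
      unfolding P_def using that order_trans[of "c x" "b x" "a x" for x] by (simp add: P_def)
  qed (simp_all add: P_def fun_eq_iff order_antisym)
  have "\<exists>m\<in>A. \<forall>a\<in>A. P m a \<longrightarrow> a = m"
  proof (rule predicate_Zorn[OF po])
    fix C assume C: "C \<in> Chains (relation_of P A)"
    then have CA: "q \<in> A" if "q \<in> C" for q
      using that by (auto simp: Chains_def relation_of_def)
    have tot: "P q r \<or> P r q" if "q \<in> C" "r \<in> C" for q r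
      using C that by (auto simp: Chains_def relation_of_def)
    show "\<exists>u\<in>A. \<forall>a\<in>C. P a u"
    proof (cases "C = {}")
      case True
      then show ?thesis using p by (auto simp: A_def)
    next
      case False
      define u where "u = (\<lambda>x. INF q\<in>C. q x)"
      have bdd: "bdd_below ((\<lambda>q. q x) ` C)" for x
      proof (rule bdd_belowI2[where m = "- p (- x)"])
        fix q assume "q \<in> C"
        then have "sublinear q" "q (- x) \<le> p (- x)" using CA by (auto simp: A_def)
        then show "- p (- x) \<le> q x" using sublinear_minus[of q x] by linarith
      qed
      have le: "u x \<le> q x" if "q \<in> C" for x q
        unfolding u_def using that by (intro cINF_lower bdd)
      have ge: "m \<le> u x" if "\<And>q. q \<in> C \<Longrightarrow> m \<le> q x" for m x
        unfolding u_def using that False by (intro cINF_greatest)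
      have subl: "sublinear q" if "q \<in> C" for q using CA[OF that] by (simp add: A_def)
      have "sublinear u"
      proof (rule sublinearI)
        fix x y
        have "u (x + y) - u x \<le> u y"
        proof (rule ge)
          fix r assume r: "r \<in> C"
          have "u (x + y) - r y \<le> u x"
          proof (rule ge)
            fix q assume q: "q \<in> C"
            \<comment> \<open>The smaller of the two comparable functionals serves at both points,
              so the infima over \<open>q\<close> and \<open>r\<close> can be taken
              separately.\<close>
            obtain s where s: "s \<in> C" "s x \<le> q x" "s y \<le> r y"
              using tot[OF q r] q r by (auto simp: P_def)
            then have "u (x + y) \<le> s x + s y"
              using le[OF s(1), of "x + y"] sublinear_add[OF subl[OF s(1)], of x y] by linarith
            then show "u (x + y) - r y \<le> q x" using s by linarith
          qed
          then show "u (x + y) - u x \<le> r y" by simp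
        qed
        then show "u (x + y) \<le> u x + u y" by simp
      next
        show "u 0 = 0"
        proof -
          have "(\<lambda>q. q 0) ` C = {0}" using False by (auto simp: sublinear_zero[OF subl])
          then show ?thesis by (simp add: u_def)
        qed
      next
        fix t :: real and x assume t: "0 < t"
        have "u (t *\<^sub>R x) / t \<le> u x"
        proof (rule ge)
          fix q assume q: "q \<in> C"
          show "u (t *\<^sub>R x) / t \<le> q x"
            using le[OF q, of "t *\<^sub>R x"] sublinear_scale[OF subl[OF q], of t x] t
            by (simp add: field_simps)
        qed
        then show "u (t *\<^sub>R x) \<le> t * u x" using t by (simp add: field_simps)
      qed
      moreover have "u x \<le> p x" for x
      proof -
        from False obtain q where "q \<in> C" by blast
        then have "u x \<le> q x" "q x \<le> p x" using le CA by (auto simp: A_def)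
        then show ?thesis by simp
      qed
      ultimately have "u \<in> A" by (simp add: A_def)
      then show ?thesis using le by (auto simp: P_def)
    qed
  qed
  then obtain m where m: "m \<in> A" "\<And>a. a \<in> A \<Longrightarrow> P m a \<Longrightarrow> a = m" by blast
  show thesis
  proof (rule that)
    show "sublinear m" "m x \<le> p x" for x using m(1) by (auto simp: A_def)
    show "q = m" if "sublinear q" "\<And>x. q x \<le> m x" for q
    proof (rule m(2))
      have "q x \<le> p x" for x using m(1) order_trans[OF that(2)] by (auto simp: A_def)
      then show "q \<in> A" using that(1) by (simp add: A_def)
    qed (use that(2) in \<open>simp add: P_def\<close>)
  qed
qed

text \<open>A minimal sublinear functional is additive, since its descents cannot be smaller.\<close>

lemma sublinear_dominates_linear:
  assumes p: "sublinear p"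
  obtains f where "linear f" "\<And>x. f x \<le> p x"
proof -
  obtain m where m: "sublinear m" "\<And>x. m x \<le> p x"
    and min: "\<And>q. sublinear q \<Longrightarrow> (\<And>x. q x \<le> m x) \<Longrightarrow> q = m"
    by (rule sublinear_minimal[OF p]) blast
  have add: "m (x + y) = m x + m y" for x y
  proof -
    obtain q where q: "sublinear q" "\<And>z t. 0 \<le> t \<Longrightarrow> q z \<le> m (z + t *\<^sub>R y) - t * m y"
      using sublinear_descent[OF m(1), of y] by blast
    \<comment> \<open>The parameter 0 puts \<open>q\<close> below \<open>m\<close>, so minimality
      gives equality; the parameter 1 is then superadditivity of \<open>m\<close>.\<close>
    have "q = m" using q(2)[of 0] by (intro min q(1)) simp
    then have "m x \<le> m (x + y) - m y" using q(2)[of 1 x] by simp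
    with sublinear_add[OF m(1), of x y] show ?thesis by simp
  qed
  have minus: "m (- x) = - m x" for x
    using add[of x "- x"] sublinear_zero[OF m(1)] by simp
  have "linear m"
  proof (rule linearI)
    show "m (r *\<^sub>R x) = r *\<^sub>R m x" for r x
    proof (cases "0 \<le> r")
      case False
      then show ?thesis
        using sublinear_scale[OF m(1), of "- r" x] by (simp add: minus)
    qed (simp add: sublinear_scale[OF m(1)])
  qed (rule add)
  with m(2) show thesis by (rule that[rotated 1])
qed

section \<open>Functionals attaining the norm, first real, then over the scalar field\<close>

text \<open>A linear functional below the descent of the norm along \<open>u\<close> stays below the
  norm, and its value at \<open>- u\<close> is at most \<open>- norm u\<close>.\<close>

lemma norming_functional_real:
  fixes u :: "'a::real_normed_vector"
  obtains f :: "'a \<Rightarrow> real" where "linear f" "\<And>x. f x \<le> norm x" "f u = norm u"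
proof -
  obtain q :: "'a \<Rightarrow> real" where q: "sublinear q"
      "\<And>x t. 0 \<le> t \<Longrightarrow> q x \<le> norm (x + t *\<^sub>R u) - t * norm u"
    using sublinear_descent[OF sublinear_norm, of u] by blast
  obtain f where f: "linear f" "\<And>x. f x \<le> q x"
    using sublinear_dominates_linear[OF q(1)] by blast
  have le: "f x \<le> norm x" for x using f(2)[of x] q(2)[of 0 x] by simp
  moreover have "f (- u) \<le> - norm u" using f(2)[of "- u"] q(2)[of 1 "- u"] by simp
  then have "f u = norm u" using le[of u] linear_neg[OF f(1), of u] by simp
  ultimately show thesis using f(1) by (intro that)
qed

text \<open>The image of 1 is idempotent and has norm 1, hence equals 1; real scaling does the
  rest.\<close>

lemma to_complex_of_real: "to_complex (of_real r :: 'k::real_or_complex) = of_real r"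
proof -
  have "to_complex (1::'k) * to_complex (1::'k) = to_complex (1::'k)" "to_complex (1::'k) \<noteq> 0"
    using to_complex_mult[of "1::'k" 1] norm_to_complex[of "1::'k"] by auto
  then have "to_complex (1::'k) = 1" by simp
  then show ?thesis
    unfolding of_real_def by (simp only: to_complex_scaleR)
qed

lemma to_complex_diff: "to_complex (a - b) = to_complex a - to_complex (b::'k::real_or_complex)"
  using to_complex_add[of "a - b" b] by simp

lemma to_complex_eq_iff: "to_complex a = to_complex b \<longleftrightarrow> a = (b::'k::real_or_complex)"
  using norm_to_complex[of "a - b"] by (auto simp: to_complex_diff)

text \<open>Rotation by a unimodular scalar turns bounds on real parts into bounds on moduli and
  lets a perturbation be aligned with the value of a functional.\<close>

lemma rotate_to_norm:
  fixes z :: "'k::real_or_complex"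
  obtains c where "norm c = 1" "c * z = of_real (norm z)"
proof (cases "z = 0")
  case False
  then have "norm (of_real (norm z) / z) = 1" "of_real (norm z) / z * z = of_real (norm z)"
    by (simp_all add: norm_divide)
  then show thesis by (rule that)
qed (auto intro: that[of 1])

context banach_space_over
begin

text \<open>In the complex case this is the usual complexification \<open>g y - \<i> g (\<i> y)\<close> of a real functional.\<close>

lemma norming_functional:
  fixes u :: 'a
  obtains f :: "'a \<Rightarrow> 'k" where "\<And>x y. f (x + y) = f x + f y" "\<And>c x. f (smul c x) = c * f x"
    "\<And>x. norm (f x) \<le> norm x" "f u = of_real (norm u)"
proof -
  obtain g :: "'a \<Rightarrow> real" where g: "linear g" "\<And>x. g x \<le> norm x" "g u = norm u"
    by (rule norming_functional_real[of u]) blast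
  have g_of_real: "g (smul (of_real r) x) = r * g x" for r x
    using linear_scale[OF g(1), of r x] by (simp add: scale_of_real)
  have "\<exists>f :: 'a \<Rightarrow> 'k. (\<forall>x y. f (x + y) = f x + f y) \<and> (\<forall>c x. f (smul c x) = c * f x) \<and>
      (\<forall>x. Re (to_complex (f x)) = g x)"
    using range_to_complex[where 'a = 'k]
  proof
    assume R: "range (to_complex :: 'k \<Rightarrow> complex) = \<real>"
    have scalar: "\<exists>r. c = of_real r" for c :: 'k
    proof -
      have "to_complex c \<in> \<real>" using R by blast
      then obtain r where "to_complex c = of_real r" by (elim Reals_cases)
      then have "to_complex c = to_complex (of_real r :: 'k)" by (simp add: to_complex_of_real)
      then show ?thesis by (auto simp: to_complex_eq_iff)
    qed
    have "of_real (g (smul c x)) = c * (of_real (g x) :: 'k)" for c x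
      using scalar[of c] by (auto simp: g_of_real)
    then show ?thesis
      by (intro exI[of _ "\<lambda>x. of_real (g x)"]) (simp add: linear_add[OF g(1)] to_complex_of_real)
  next
    assume C: "surj (to_complex :: 'k \<Rightarrow> complex)"
    then obtain j :: 'k where j: "to_complex j = \<i>" by (metis surjD)
    have "to_complex (j * j) = to_complex (- 1 :: 'k)"
      using to_complex_of_real[of "-1", where 'k = 'k] by (simp add: to_complex_mult j)
    then have jj: "j * j = - 1" by (simp only: to_complex_eq_iff)
    \<comment> \<open>By this decomposition, homogeneity has to be checked only for real scalars and
      for \<open>j\<close>.\<close>
    have scalar: "\<exists>a b. c = of_real a + of_real b * j" for c :: 'k
    proof (intro exI)
      have "to_complex c = to_complex (of_real (Re (to_complex c)) + of_real (Im (to_complex c)) * j)"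
        by (simp add: to_complex_add to_complex_mult to_complex_of_real j complex_eq_iff)
      then show "c = of_real (Re (to_complex c)) + of_real (Im (to_complex c)) * j"
        by (simp only: to_complex_eq_iff)
    qed
    define f where "f x = of_real (g x) - j * of_real (g (smul j x))" for x
    have add: "f (x + y) = f x + f y" for x y
      by (simp add: f_def linear_add[OF g(1)] scale_right_distrib algebra_simps)
    have f_of_real: "f (smul (of_real r) x) = of_real r * f x" for r x
      using g_of_real[of r "smul j x"] by (simp add: f_def g_of_real mult.commute right_diff_distrib)
    have "smul j (smul j x) = - x" for x
      by (simp add: jj scale_minus_left)
    then have f_j: "f (smul j x) = j * f x" for x
      using linear_neg[OF g(1), of x] by (simp add: f_def right_diff_distrib jj flip: mult.assoc)
    have "f (smul c x) = c * f x" for c x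
    proof -
      obtain a b where c: "c = of_real a + of_real b * j" using scalar by blast
      have "smul c x = smul (of_real a) x + smul (of_real b) (smul j x)"
        by (simp add: c scale_left_distrib)
      then have "f (smul c x) = of_real a * f x + of_real b * (j * f x)"
        by (simp only: add f_of_real f_j)
      then show ?thesis by (simp add: c algebra_simps)
    qed
    moreover have "Re (to_complex (f x)) = g x" for x
      by (simp add: f_def to_complex_diff to_complex_mult to_complex_of_real j)
    ultimately show ?thesis using add by blast
  qed
  then obtain f :: "'a \<Rightarrow> 'k" where add: "\<And>x y. f (x + y) = f x + f y"
    and scale: "\<And>c x. f (smul c x) = c * f x" and Re: "\<And>x. Re (to_complex (f x)) = g x"
    by blast
  have le: "norm (f x) \<le> norm x" for x
  proof -
    \<comment> \<open>After the rotation the value is real, so it equals its real part, which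
      \<open>g\<close> controls.\<close>
    obtain c where c: "norm c = 1" "c * f x = of_real (norm (f x))"
      using rotate_to_norm .
    then have "norm (f x) = g (smul c x)"
      using Re[of "smul c x"] by (simp add: scale to_complex_of_real)
    also have "\<dots> \<le> norm x" using g(2)[of "smul c x"] c(1) by (simp add: norm_scale)
    finally show ?thesis .
  qed
  \<comment> \<open>The real part at \<open>u\<close> already reaches the bound for the modulus, so
    no imaginary part is left.\<close>
  have "cmod (to_complex (f u)) \<le> Re (to_complex (f u))"
    using le[of u] by (simp add: Re g(3) norm_to_complex)
  then have "cmod (to_complex (f u)) = Re (to_complex (f u))"
    using complex_Re_le_cmod[of "to_complex (f u)"] by simp
  then have "Im (to_complex (f u)) = 0"
    using cmod_power2[of "to_complex (f u)"] by simp
  then have "to_complex (f u) = of_real (norm u)"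
    using Re[of u] g(3) by (simp add: complex_eq_iff)
  then have "f u = of_real (norm u)"
    using to_complex_eq_iff[of "f u" "of_real (norm u)"] by (simp add: to_complex_of_real)
  with add scale le show thesis by (rule that)
qed

end

section \<open>Numerical radius and perturbations of the identity\<close>

text \<open>The records carry no axioms. This isolates what normalising a vector uses, in a form
  shared by subspaces, ultrapowers and the scalar field.\<close>

definition homogeneous_norm :: "('k::real_or_complex, 'a) nspace \<Rightarrow> bool"
  where "homogeneous_norm E \<longleftrightarrow> (\<forall>x\<in>vcarrier E. 0 \<le> vnorm E x \<and>
    (\<forall>c. vscale E c x \<in> vcarrier E \<and> vnorm E (vscale E c x) = norm c * vnorm E x))"

text \<open>Normalising \<open>x\<close> reduces the claim to the unit ball. A vector of norm 0
  cannot be normalised; there the bound \<open>B\<close> gives the claim.\<close>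

lemma operator_norm_le_oneD:
  assumes E: "homogeneous_norm E" and F: "homogeneous_norm F"
    and T: "T \<in> bounded_operators E F" and le: "operator_norm E F T \<le> 1"
    and x: "x \<in> vcarrier E"
  shows "vnorm F (T x) \<le> vnorm E x"
proof (cases "vnorm E x = 0")
  case True
  obtain B where "\<And>y. y \<in> vcarrier E \<Longrightarrow> vnorm F (T y) \<le> B * vnorm E y"
    using T unfolding bounded_operators_def by blast
  from this[OF x] True show ?thesis by simp
next
  case False
  define r where "r = vnorm E x"
  have r: "0 < r" using False E x by (auto simp: homogeneous_norm_def r_def order_less_le)
  define y where "y = vscale E (of_real (inverse r)) x"
  have y: "y \<in> vcarrier E" "vnorm E y = 1"
    using E x r by (auto simp: homogeneous_norm_def y_def norm_inverse simp flip: r_def)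
  have "ennreal (vnorm F (T y)) \<le> operator_norm E F T"
    unfolding operator_norm_def using y by (intro SUP_upper) auto
  then have "vnorm F (T y) \<le> 1" using le by (meson ennreal_le_1 order_trans)
  moreover have "vnorm F (T y) = inverse r * vnorm F (T x)"
    using T F x r by (auto simp: bounded_operators_def homogeneous_norm_def y_def norm_inverse)
  ultimately show ?thesis using r by (simp add: field_simps flip: r_def)
qed

lemma homogeneous_norm_scalar_space: "homogeneous_norm (scalar_space :: ('k::real_or_complex, 'k) nspace)"
  by (simp add: homogeneous_norm_def scalar_space_def norm_mult)

lemma dual_sphereD:
  assumes "homogeneous_norm E" and "f \<in> dual_sphere E" and "x \<in> vcarrier E"
  shows "norm (f x) \<le> vnorm E x"
  using operator_norm_le_oneD[OF assms(1) homogeneous_norm_scalar_space _ _ assms(3), of f] assms(2)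
  by (auto simp: dual_sphere_def scalar_space_def)

context banach_space_over
begin

lemma homogeneous_norm_subspace:
  assumes "closed_subspace smul X"
  shows "homogeneous_norm (subspace_nspace smul X)"
  using assms
  by (auto simp: homogeneous_norm_def subspace_nspace_def closed_subspace_def subspace_def norm_scale)

text \<open>A functional norming \<open>z\<close>, paired with the normalised \<open>z\<close>, is
  admissible in the numerical radius. It therefore bounds the value at \<open>T z\<close> by
  \<open>c * norm z\<close>, and the reverse triangle inequality at \<open>z - smul l (T z)\<close>
  concludes.\<close>

lemma numerical_radius_dissipative:
  assumes X: "closed_subspace smul X"
    and T: "T \<in> bounded_operators (subspace_nspace smul X) (subspace_nspace smul X)"
    and v: "numerical_radius (subspace_nspace smul X) T \<le> ennreal c" and c: "0 \<le> c"
    and z: "z \<in> X"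
  shows "(1 - norm l * c) * norm z \<le> norm (z - smul l (T z))"
proof (cases "z = 0")
  case False
  let ?E = "subspace_nspace smul X"
  obtain f :: "'a \<Rightarrow> 'k" where add: "\<And>x y. f (x + y) = f x + f y"
    and scale: "\<And>c x. f (smul c x) = c * f x" and le: "\<And>x. norm (f x) \<le> norm x"
    and fz: "f z = of_real (norm z)"
    using norming_functional[of z] by blast
  define k :: 'k where "k = of_real (inverse (norm z))"
  define u where "u = smul k z"
  have Tu: "T u = smul k (T z)"
    using T z by (auto simp: bounded_operators_def subspace_nspace_def u_def)
  have u: "u \<in> X" "norm u = 1" "f u = 1"
    using X z False by (auto simp: u_def k_def closed_subspace_def subspace_def norm_scale scale fz
        norm_inverse)
  \<comment> \<open>The functional lives on the whole space; its restriction keeps norm 1 because it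
    attains 1 at \<open>u\<close>, which lies in \<open>X\<close>.\<close>
  have "operator_norm ?E scalar_space f = 1"
    unfolding operator_norm_def
  proof (rule antisym)
    show "(SUP x\<in>{x \<in> vcarrier ?E. vnorm ?E x \<le> 1}. ennreal (vnorm scalar_space (f x))) \<le> 1"
      using le order_trans
      by (intro SUP_least) (auto simp: subspace_nspace_def scalar_space_def)
    have "1 \<le> ennreal (vnorm scalar_space (f u))" by (simp add: scalar_space_def u)
    then show "1 \<le> (SUP x\<in>{x \<in> vcarrier ?E. vnorm ?E x \<le> 1}. ennreal (vnorm scalar_space (f x)))"
      using u by (intro SUP_upper2[of u]) (auto simp: subspace_nspace_def)
  qed
  moreover have "f \<in> bounded_operators ?E scalar_space"
    using add scale le
    by (auto simp: bounded_operators_def subspace_nspace_def scalar_space_def intro!: exI[of _ 1])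
  ultimately have "f \<in> dual_sphere ?E" by (simp add: dual_sphere_def)
  then have "ennreal (norm (f (T u))) \<le> numerical_radius ?E T"
    unfolding numerical_radius_def using u
    by (intro SUP_upper2[of "(u, f)"]) (auto simp: unit_sphere_def subspace_nspace_def)
  then have "norm (f (T u)) \<le> c" using v c by (meson ennreal_le_iff order_trans)
  then have fTz: "norm (f (T z)) \<le> c * norm z"
    using False by (simp add: Tu scale k_def norm_mult norm_divide field_simps)
  have "f (z - smul l (T z)) = f z - l * f (T z)"
    using add[of "z - smul l (T z)" "smul l (T z)"] by (simp add: scale)
  then have "norm z - norm l * norm (f (T z)) \<le> norm (f (z - smul l (T z)))"
    using norm_triangle_ineq2[of "f z" "l * f (T z)"] by (simp add: fz norm_mult)
  moreover have "norm l * norm (f (T z)) \<le> norm l * (c * norm z)"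
    using fTz by (intro mult_left_mono) auto
  ultimately show ?thesis using le[of "z - smul l (T z)"] by (simp add: algebra_simps)
qed simp

text \<open>
  Dissipativity applied to \<open>x + l T x\<close>. Unlike the classical formula for the numerical radius as a
  limit, this bound is uniform over the contractions \<open>T\<close> with numerical radius at most \<open>c\<close>.
\<close>

lemma numerical_radius_perturbation:
  assumes X: "closed_subspace smul X"
    and T: "T \<in> bounded_operators (subspace_nspace smul X) (subspace_nspace smul X)"
    and contr: "\<And>x. x \<in> X \<Longrightarrow> norm (T x) \<le> norm x"
    and v: "numerical_radius (subspace_nspace smul X) T \<le> ennreal c" and c: "0 \<le> c"
    and x: "x \<in> X"
  shows "(1 - norm l * c) * norm (x + smul l (T x)) \<le> (1 + (norm l)\<^sup>2) * norm x"
proof -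
  have TX: "T y \<in> X" if "y \<in> X" for y
    using T that by (auto simp: bounded_operators_def subspace_nspace_def)
  have sX: "smul a y \<in> X" if "y \<in> X" for a y
    using X that by (auto simp: closed_subspace_def subspace_def)
  define z where "z = x + smul l (T x)"
  have "z \<in> X" using X TX[OF x] sX x by (auto simp: closed_subspace_def subspace_def z_def)
  have "T z = T x + smul l (T (T x))"
    using T TX[OF x] sX x by (auto simp: bounded_operators_def subspace_nspace_def z_def)
  \<comment> \<open>The terms of first order in \<open>l\<close> cancel, so the remaining error is
    quadratic.\<close>
  then have "z - smul l (T z) = x - smul (l * l) (T (T x))"
    by (simp add: z_def scale_right_distrib)
  then have "norm (z - smul l (T z)) \<le> norm x + (norm l)\<^sup>2 * norm (T (T x))"
    using norm_triangle_ineq4[of x "smul (l * l) (T (T x))"]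
    by (simp add: norm_scale norm_mult power2_eq_square)
  also have "\<dots> \<le> norm x + (norm l)\<^sup>2 * norm x"
    using contr[OF x] contr[OF TX[OF x]] by (intro add_left_mono mult_left_mono) auto
  finally show ?thesis
    using numerical_radius_dissipative[OF X T v c \<open>z \<in> X\<close>, of l]
    by (simp add: z_def algebra_simps)
qed

end

section \<open>Transfer of operators along the gap\<close>

context banach_space_over
begin

text \<open>The defects of linearity are relative to the norms of the arguments, so along bounded
  sequences they vanish with \<open>e\<close>. The norm bound is exact, which keeps bounded
  sequences bounded.\<close>

definition almost_linear_contraction :: "'a set \<Rightarrow> real \<Rightarrow> ('a \<Rightarrow> 'a) \<Rightarrow> bool"
  where "almost_linear_contraction X e A \<longleftrightarrow>
    (\<forall>x\<in>X. A x \<in> X \<and> norm (A x) \<le> norm x) \<and>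
    (\<forall>x\<in>X. \<forall>y\<in>X. norm (A (x + y) - (A x + A y)) \<le> e * (norm x + norm y)) \<and>
    (\<forall>c. \<forall>x\<in>X. norm (A (smul c x) - smul c (A x)) \<le> e * (norm c * norm x))"

lemma almost_linear_contractionD:
  assumes "almost_linear_contraction X e A" and "x \<in> X"
  shows "A x \<in> X" and "norm (A x) \<le> norm x"
    and "y \<in> X \<Longrightarrow> norm (A (x + y) - (A x + A y)) \<le> e * (norm x + norm y)"
    and "norm (A (smul c x) - smul c (A x)) \<le> e * (norm c * norm x)"
  using assms by (auto simp: almost_linear_contraction_def)

lemma closed_subspaceD:
  assumes "closed_subspace smul X" and "x \<in> X"
  shows "smul c x \<in> X" and "r *\<^sub>R x \<in> X"
    and "y \<in> X \<Longrightarrow> x + y \<in> X" and "y \<in> X \<Longrightarrow> x - y \<in> X"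
  using assms subspace_diff[of X x y] subspace_scale[of X x "of_real r"]
  by (auto simp: closed_subspace_def subspace_def scale_of_real)

lemma gap_commute: "gap W Z = gap Z W"
  by (simp add: gap_def max.commute)

text \<open>The gap compares unit spheres, so vectors are normalised, approximated and scaled back,
  which preserves norms exactly. The selection is a bare choice and need not be linear.\<close>

lemma gap_approximation:
  assumes W: "closed_subspace smul W" and Z: "closed_subspace smul Z"
    and gap: "gap W Z < ennreal d"
  obtains \<phi> where "\<And>w. w \<in> W \<Longrightarrow> \<phi> w \<in> Z" "\<And>w. w \<in> W \<Longrightarrow> norm (\<phi> w) = norm w"
    "\<And>w. w \<in> W \<Longrightarrow> norm (w - \<phi> w) \<le> d * norm w"
proof -
  have "\<exists>z. z \<in> Z \<and> norm z = norm w \<and> norm (w - z) \<le> d * norm w" if w: "w \<in> W" for w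
  proof (cases "w = 0")
    case True
    then show ?thesis using Z by (auto simp: closed_subspace_def subspace_def)
  next
    case False
    define u where "u = inverse (norm w) *\<^sub>R w"
    have u: "u \<in> W \<inter> sphere 0 1"
      using closed_subspaceD(2)[OF W w] False by (simp add: u_def)
    have "set_dist u (Z \<inter> sphere 0 1) \<le> gap W Z"
      unfolding gap_def using u by (intro max.coboundedI1 SUP_upper)
    then have "set_dist u (Z \<inter> sphere 0 1) < ennreal d" using gap by (rule order_le_less_trans)
    \<comment> \<open>The distance to an empty sphere is infinite, so the strict finite bound also
      guarantees that \<open>Z\<close> is nonzero.\<close>
    then obtain v where v: "v \<in> Z" "norm v = 1" "ennreal (dist u v) < ennreal d"
      unfolding set_dist_def INF_less_iff by auto
    then have "dist u v < d" by (simp add: ennreal_less_iff)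
    have "w = norm w *\<^sub>R u" using False by (simp add: u_def)
    then have "w - norm w *\<^sub>R v = norm w *\<^sub>R (u - v)"
      by (simp add: scaleR_diff_right)
    then have "norm (w - norm w *\<^sub>R v) = norm w * dist u v"
      by (simp add: dist_norm)
    also have "\<dots> \<le> norm w * d" using \<open>dist u v < d\<close> by (intro mult_left_mono) auto
    finally show ?thesis
      using v closed_subspaceD(2)[OF Z v(1)]
      by (intro exI[of _ "norm w *\<^sub>R v"]) (simp add: mult.commute)
  qed
  then obtain \<phi> where "\<forall>w\<in>W. \<phi> w \<in> Z \<and> norm (\<phi> w) = norm w \<and> norm (w - \<phi> w) \<le> d * norm w"
    by metis
  then show thesis by (intro that[of \<phi>]) auto
qed

text \<open>An operator \<open>T\<close> on \<open>W\<close> of norm 1 and numerical radius below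
  \<open>c\<close> is composed with the selections \<open>\<phi>\<close> from \<open>Z\<close> to
  \<open>W\<close> and \<open>\<psi>\<close> from \<open>W\<close> to \<open>Z\<close>. As
  \<open>T\<close> is a linear contraction, all errors come from the selections.\<close>

lemma gap_transfer_operator:
  assumes W: "closed_subspace smul W" and Z: "closed_subspace smul Z"
    and gap: "gap W Z < ennreal d"
    and index: "numerical_index (subspace_nspace smul W) < ennreal c" and c: "0 \<le> c"
  obtains A where "almost_linear_contraction Z (4 * d) A"
    and "\<And>l x. x \<in> Z \<Longrightarrow> norm l * c \<le> 1 \<Longrightarrow>
      (1 - norm l * c) * norm (x + smul l (A x)) \<le> (1 + (norm l)\<^sup>2 + (1 + norm l) * d) * norm x"
    and "\<exists>x\<in>Z. norm x \<le> 1 \<and> 1 - 3 * d \<le> norm (A x)"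
proof -
  let ?E = "subspace_nspace smul W"
  have d: "0 < d" using gap by (metis ennreal_eq_0_iff not_less not_less_zero)
  obtain \<phi> where \<phi>: "\<And>x. x \<in> Z \<Longrightarrow> \<phi> x \<in> W" "\<And>x. x \<in> Z \<Longrightarrow> norm (\<phi> x) = norm x"
    "\<And>x. x \<in> Z \<Longrightarrow> norm (x - \<phi> x) \<le> d * norm x"
    using gap_approximation[OF Z W] gap by (metis gap_commute)
  obtain \<psi> where \<psi>: "\<And>x. x \<in> W \<Longrightarrow> \<psi> x \<in> Z" "\<And>x. x \<in> W \<Longrightarrow> norm (\<psi> x) = norm x"
    "\<And>x. x \<in> W \<Longrightarrow> norm (x - \<psi> x) \<le> d * norm x"
    using gap_approximation[OF W Z gap] by metis
  obtain T where T: "T \<in> bounded_operators ?E ?E" "operator_norm ?E ?E T = 1"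
    "numerical_radius ?E T < ennreal c"
    using index unfolding numerical_index_def INF_less_iff by auto
  have TW: "T w \<in> W" if "w \<in> W" for w
    using T(1) that by (auto simp: bounded_operators_def subspace_nspace_def)
  have Tadd: "T (v + w) = T v + T w" if "v \<in> W" "w \<in> W" for v w
    using T(1) that by (auto simp: bounded_operators_def subspace_nspace_def)
  have Tscale: "T (smul a w) = smul a (T w)" if "w \<in> W" for a w
    using T(1) that by (auto simp: bounded_operators_def subspace_nspace_def)
  have Tle: "norm (T w) \<le> norm w" if "w \<in> W" for w
    using operator_norm_le_oneD[OF homogeneous_norm_subspace[OF W] homogeneous_norm_subspace[OF W]
        T(1), of w] T(2) that
    by (simp add: subspace_nspace_def)
  have Tdiff: "norm (T v - T w) \<le> norm (v - w)" if "v \<in> W" "w \<in> W" for v w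
    using Tadd[of "v - w" w] Tle[of "v - w"] closed_subspaceD(4)[OF W] that by simp
  define A where "A x = \<psi> (T (\<phi> x))" for x
  have near: "norm (A x - T (\<phi> x)) \<le> d * norm x" if "x \<in> Z" for x
  proof -
    have "norm (A x - T (\<phi> x)) \<le> d * norm (T (\<phi> x))"
      using \<psi>(3)[of "T (\<phi> x)"] TW \<phi>(1) that by (simp add: A_def norm_minus_commute)
    also have "\<dots> \<le> d * norm x"
      using Tle[of "\<phi> x"] \<phi> that d by (intro mult_left_mono) auto
    finally show ?thesis .
  qed
  have AZ: "A x \<in> Z" "norm (A x) = norm (T (\<phi> x))" if "x \<in> Z" for x
    using \<psi> TW \<phi> that by (auto simp: A_def)
  have tri: "norm (p - q) \<le> norm (p - r) + norm (r - q)" for p q r :: 'a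
    using norm_triangle_ineq[of "p - r" "r - q"] by simp
  have sub: "norm (p - q) \<le> norm (p - p') + norm (p' - q') + norm (q - q')" for p q p' q' :: 'a
    using tri[of p q p'] tri[of p' q q']
    by (simp add: norm_minus_commute)
  have "almost_linear_contraction Z (4 * d) A"
    unfolding almost_linear_contraction_def
  proof (intro conjI ballI allI)
    fix x assume x: "x \<in> Z"
    show "A x \<in> Z" using AZ x by simp
    show "norm (A x) \<le> norm x" using AZ(2)[OF x] Tle[OF \<phi>(1)[OF x]] \<phi>(2)[OF x] by simp
  next
    fix x y assume x: "x \<in> Z" and y: "y \<in> Z"
    have xy: "x + y \<in> Z" using closed_subspaceD(3)[OF Z x y] .
    have W': "\<phi> x + \<phi> y \<in> W" using closed_subspaceD(3)[OF W] \<phi>(1) x y by simp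
    have sum: "norm (p + q - (r + s)) \<le> norm (p - r) + norm (q - s)" for p q r s :: 'a
      using norm_triangle_ineq[of "p - r" "q - s"] by (simp add: algebra_simps)
    have "norm (T (\<phi> (x + y)) - (T (\<phi> x) + T (\<phi> y))) \<le> norm (\<phi> (x + y) - (\<phi> x + \<phi> y))"
      using Tdiff[OF \<phi>(1)[OF xy] W'] Tadd \<phi>(1) x y by simp
    also have "\<dots> \<le> norm (\<phi> (x + y) - (x + y)) + norm (x + y - (\<phi> x + \<phi> y))"
      by (rule tri)
    also have "\<dots> \<le> d * norm (x + y) + (d * norm x + d * norm y)"
      using \<phi>(3)[OF xy] \<phi>(3)[OF x] \<phi>(3)[OF y] sum[of x y "\<phi> x" "\<phi> y"]
      by (simp add: norm_minus_commute)
    finally have 1: "norm (T (\<phi> (x + y)) - (T (\<phi> x) + T (\<phi> y))) \<le>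
        d * norm (x + y) + (d * norm x + d * norm y)" .
    have 2: "norm (A x + A y - (T (\<phi> x) + T (\<phi> y))) \<le> d * norm x + d * norm y"
      using sum[of "A x" "A y" "T (\<phi> x)" "T (\<phi> y)"] near[OF x] near[OF y] by simp
    have 3: "d * norm (x + y) \<le> d * norm x + d * norm y"
      using mult_left_mono[OF norm_triangle_ineq[of x y], of d] d by (simp add: distrib_left)
    \<comment> \<open>Replacing \<open>A\<close> by \<open>T\<close> after \<open>\<phi>\<close>
      costs \<open>d\<close> times each of the norms of \<open>x + y\<close>, \<open>x\<close> and
      \<open>y\<close>; the additivity defect of \<open>\<phi>\<close> costs the same again. The
      triangle inequality turns this into the factor 4.\<close>
    show "norm (A (x + y) - (A x + A y)) \<le> 4 * d * (norm x + norm y)"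
      using sub[of "A (x + y)" "A x + A y" "T (\<phi> (x + y))" "T (\<phi> x) + T (\<phi> y)"]
        near[OF xy] 1 2 3 by (simp add: algebra_simps)
  next
    fix a x assume x: "x \<in> Z"
    have ax: "smul a x \<in> Z" using closed_subspaceD(1)[OF Z x] .
    have W': "smul a (\<phi> x) \<in> W" using closed_subspaceD(1)[OF W] \<phi>(1) x by simp
    have scale: "norm (smul a p - smul a q) = norm a * norm (p - q)" for p q :: 'a
      by (simp add: norm_scale flip: scale_right_diff_distrib)
    have "norm (T (\<phi> (smul a x)) - smul a (T (\<phi> x))) \<le> norm (\<phi> (smul a x) - smul a (\<phi> x))"
      using Tdiff[OF \<phi>(1)[OF ax] W'] Tscale \<phi>(1) x by simp
    also have "\<dots> \<le> norm (\<phi> (smul a x) - smul a x) + norm (smul a x - smul a (\<phi> x))"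
      by (rule tri)
    also have "\<dots> \<le> d * norm (smul a x) + norm a * (d * norm x)"
      using \<phi>(3)[OF ax] \<phi>(3)[OF x] mult_left_mono[OF \<phi>(3)[OF x], of "norm a"]
      by (simp add: norm_minus_commute scale)
    finally have 1: "norm (T (\<phi> (smul a x)) - smul a (T (\<phi> x))) \<le>
        d * norm (smul a x) + norm a * (d * norm x)" .
    have 2: "norm (smul a (A x) - smul a (T (\<phi> x))) \<le> norm a * (d * norm x)"
      unfolding scale using near[OF x] by (intro mult_left_mono) auto
    show "norm (A (smul a x) - smul a (A x)) \<le> 4 * d * (norm a * norm x)"
      using sub[of "A (smul a x)" "smul a (A x)" "T (\<phi> (smul a x))" "smul a (T (\<phi> x))"]
        near[OF ax] 1 2 by (simp add: norm_scale algebra_simps)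
  qed
  moreover have "(1 - norm l * c) * norm (x + smul l (A x))
      \<le> (1 + (norm l)\<^sup>2 + (1 + norm l) * d) * norm x" if x: "x \<in> Z" and l: "norm l * c \<le> 1" for l x
  proof -
    have "norm (smul l (A x) - smul l (T (\<phi> x))) \<le> norm l * (d * norm x)"
      using mult_left_mono[OF near[OF x], of "norm l"]
      by (simp add: norm_scale flip: scale_right_diff_distrib)
    moreover have "norm (x + smul l (A x)) \<le> norm (\<phi> x + smul l (T (\<phi> x)))
        + (norm (x - \<phi> x) + norm (smul l (A x) - smul l (T (\<phi> x))))"
      using norm_triangle_ineq[of "\<phi> x + smul l (T (\<phi> x))"
          "(x - \<phi> x) + (smul l (A x) - smul l (T (\<phi> x)))"]
        norm_triangle_ineq[of "x - \<phi> x" "smul l (A x) - smul l (T (\<phi> x))"]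
      by (simp add: algebra_simps)
    ultimately have "norm (x + smul l (A x)) \<le>
        norm (\<phi> x + smul l (T (\<phi> x))) + (1 + norm l) * d * norm x"
      using \<phi>(3)[OF x] by (simp add: algebra_simps)
    then have "(1 - norm l * c) * norm (x + smul l (A x)) \<le> (1 - norm l * c) *
        (norm (\<phi> x + smul l (T (\<phi> x))) + (1 + norm l) * d * norm x)"
      using l by (intro mult_left_mono) auto
    \<comment> \<open>The factor lies between 0 and 1, so it may be replaced by 1 in the error
      term.\<close>
    also have "\<dots> \<le> (1 - norm l * c) * norm (\<phi> x + smul l (T (\<phi> x))) + 1 * ((1 + norm l) * d * norm x)"
      unfolding distrib_left using l c d by (intro add_left_mono mult_right_mono) auto
    also have "(1 - norm l * c) * norm (\<phi> x + smul l (T (\<phi> x))) \<le> (1 + (norm l)\<^sup>2) * norm x"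
      using numerical_radius_perturbation[OF W T(1) Tle less_imp_le[OF T(3)] c \<phi>(1)[OF x], of l]
        \<phi>(2)[OF x] by simp
    finally show ?thesis by (simp add: algebra_simps)
  qed
  moreover have "\<exists>x\<in>Z. norm x \<le> 1 \<and> 1 - 3 * d \<le> norm (A x)"
  proof -
    \<comment> \<open>The norm of \<open>T\<close> need not be attained, which costs
      \<open>d\<close>; moving \<open>w\<close> to \<open>Z\<close> and back costs
      \<open>2 * d\<close> more.\<close>
    have "ennreal (1 - d) < operator_norm ?E ?E T"
      using d T(2) by simp
    then obtain w where w: "w \<in> W" "norm w \<le> 1" "ennreal (1 - d) < ennreal (norm (T w))"
      unfolding operator_norm_def less_SUP_iff by (auto simp: subspace_nspace_def)
    have "1 - d < norm (T w)" using w(3) by (metis ennreal_leI not_less)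
    have z: "\<psi> w \<in> Z" "\<phi> (\<psi> w) \<in> W" using \<psi>(1) \<phi>(1) w by auto
    have "norm (w - \<phi> (\<psi> w)) \<le> norm (w - \<psi> w) + norm (\<psi> w - \<phi> (\<psi> w))"
      by (rule tri)
    also have "\<dots> \<le> d * norm w + d * norm w"
      using \<psi>(3)[OF w(1)] \<phi>(3)[OF z(1)] \<psi>(2)[OF w(1)] by simp
    also have "\<dots> \<le> 2 * d" using mult_left_mono[OF w(2), of d] d by simp
    finally have "norm (T w - T (\<phi> (\<psi> w))) \<le> 2 * d" using Tdiff[OF w(1) z(2)] by simp
    then have "1 - 3 * d \<le> norm (T (\<phi> (\<psi> w)))"
      using norm_triangle_ineq2[of "T w" "T (\<phi> (\<psi> w))"] \<open>1 - d < norm (T w)\<close> by simp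
    then show ?thesis using AZ(2)[OF z(1)] \<psi>(2)[OF w(1)] w(2) z(1) by (intro bexI[of _ "\<psi> w"]) auto
  qed
  ultimately show thesis by (rule that)
qed

end

section \<open>Operators on the ultrapower\<close>

lemma bounded_sequencesE:
  assumes "x \<in> bounded_sequences X"
  obtains B where "\<And>n. x n \<in> X" "\<And>n. norm (x n) \<le> B" "0 \<le> B"
proof -
  obtain B where B: "\<And>n. norm (x n) \<le> B"
    using assms by (auto simp: bounded_sequences_def bounded_iff)
  moreover have "0 \<le> B" using B[of 0] norm_ge_zero order_trans by blast
  moreover have "x n \<in> X" for n using assms by (auto simp: bounded_sequences_def)
  ultimately show thesis by (intro that)
qed

lemma bounded_sequencesI:
  assumes "\<And>n. x n \<in> X" and "\<And>n. norm (x n) \<le> B"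
  shows "x \<in> bounded_sequences X"
  using assms by (auto simp: bounded_sequences_def bounded_iff)

lemma bounded_sequences_add:
  assumes "x \<in> bounded_sequences X" and "y \<in> bounded_sequences X" and "\<And>n. x n + y n \<in> X"
  shows "(\<lambda>n. x n + y n) \<in> bounded_sequences X"
proof -
  obtain B where "\<And>n. norm (x n) \<le> B" using bounded_sequencesE[OF assms(1)] by metis
  moreover obtain C where "\<And>n. norm (y n) \<le> C" using bounded_sequencesE[OF assms(2)] by metis
  ultimately show ?thesis
    using assms(3) by (intro bounded_sequencesI[of _ _ "B + C"] norm_triangle_mono)
qed

lemma ultra_class_eqI:
  assumes "x \<in> bounded_sequences X" and "y \<in> bounded_sequences X"
    and "\<And>n. norm (x n - y n) \<le> e n" and "(e \<longlongrightarrow> 0) U"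
  shows "ultra_rel X U `` {x} = ultra_rel X U `` {y}"
proof (rule equiv_class_eq[OF equiv_ultra_rel])
  have "((\<lambda>n. norm (x n - y n)) \<longlongrightarrow> 0) U"
    by (rule Lim_null_comparison[OF _ assms(4)]) (simp add: assms(3))
  then show "(x, y) \<in> ultra_rel X U" using assms(1,2) by (simp add: ultra_rel_def)
qed

lemma vcarrier_ultrapower: "vcarrier (ultrapower smul X U) = bounded_sequences X // ultra_rel X U"
  by (simp add: ultrapower_def)

lemma class_in_ultrapower:
  "x \<in> bounded_sequences X \<Longrightarrow> ultra_rel X U `` {x} \<in> vcarrier (ultrapower smul X U)"
  by (simp add: vcarrier_ultrapower quotientI)

lemma ultrapower_cases:
  assumes "C \<in> vcarrier (ultrapower smul X U)"
  obtains x where "x \<in> bounded_sequences X" "C = ultra_rel X U `` {x}"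
  using assms by (auto simp: vcarrier_ultrapower elim: quotientE)

section \<open>The operator induced by almost linear contractions\<close>

text \<open>The maps act coordinatewise on some representative. For almost linear contractions with
  vanishing error the choice is immaterial, by \<open>ultra_map_class\<close>.\<close>

definition ultra_map ::
    "'a::real_normed_vector set \<Rightarrow> nat filter \<Rightarrow> (nat \<Rightarrow> 'a \<Rightarrow> 'a) \<Rightarrow> (nat \<Rightarrow> 'a) set \<Rightarrow> (nat \<Rightarrow> 'a) set"
  where "ultra_map X U A C = ultra_rel X U `` {\<lambda>n. A n ((SOME x. x \<in> C) n)}"

context banach_space_over
begin

lemma bounded_sequences_scale:
  assumes X: "closed_subspace smul X" and "x \<in> bounded_sequences X"
  shows "(\<lambda>n. smul c (x n)) \<in> bounded_sequences X"
proof -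
  obtain B where "\<And>n. x n \<in> X" "\<And>n. norm (x n) \<le> B" using bounded_sequencesE[OF assms(2)] by metis
  then show ?thesis
    using closed_subspaceD(1)[OF X]
    by (intro bounded_sequencesI[of _ _ "norm c * B"]) (auto simp: norm_scale mult_left_mono)
qed

lemma homogeneous_norm_ultrapower:
  assumes U: "free_ultrafilter U" and X: "closed_subspace smul X"
  shows "homogeneous_norm (ultrapower smul X U)"
  unfolding homogeneous_norm_def
proof (intro ballI conjI allI)
  have ne: "U \<noteq> bot" using U by (simp add: free_ultrafilter_def)
  fix C assume "C \<in> vcarrier (ultrapower smul X U)"
  then obtain x where x: "x \<in> bounded_sequences X" and C: "C = ultra_rel X U `` {x}"
    by (rule ultrapower_cases)
  note lim = tendsto_norm_bounded_sequence[OF U x]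
  show "0 \<le> vnorm (ultrapower smul X U) C"
    unfolding C vnorm_ultrapower[OF U x] by (rule tendsto_lowerbound[OF lim _ ne]) simp
  fix c
  have cC: "vscale (ultrapower smul X U) c C = ultra_rel X U `` {\<lambda>n. smul c (x n)}"
    unfolding C by (rule vscale_ultrapower[OF banach_space_over_axioms X x])
  show "vscale (ultrapower smul X U) c C \<in> vcarrier (ultrapower smul X U)"
    unfolding cC by (intro class_in_ultrapower bounded_sequences_scale X x)
  show "vnorm (ultrapower smul X U) (vscale (ultrapower smul X U) c C) =
      norm c * vnorm (ultrapower smul X U) C"
    unfolding cC vnorm_ultrapower[OF U bounded_sequences_scale[OF X x]]
    unfolding C vnorm_ultrapower[OF U x] norm_scale
    by (rule tendsto_Lim[OF ne]) (intro tendsto_intros lim)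
qed

context
  fixes X :: "'a set" and U :: "nat filter" and A :: "nat \<Rightarrow> 'a \<Rightarrow> 'a" and e :: "nat \<Rightarrow> real"
  assumes X: "closed_subspace smul X" and U: "free_ultrafilter U"
    and A: "\<And>n. almost_linear_contraction X (e n) (A n)"
    and e: "\<And>n. 0 \<le> e n" "(e \<longlongrightarrow> 0) U"
begin

lemma bounded_sequences_almost_linear:
  assumes "x \<in> bounded_sequences X"
  shows "(\<lambda>n. A n (x n)) \<in> bounded_sequences X"
proof -
  obtain B where B: "\<And>n. x n \<in> X" "\<And>n. norm (x n) \<le> B" using bounded_sequencesE[OF assms] by metis
  show ?thesis
  proof (rule bounded_sequencesI)
    show "A n (x n) \<in> X" for n by (rule almost_linear_contractionD(1)[OF A B(1)])
    show "norm (A n (x n)) \<le> B" for n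
      using almost_linear_contractionD(2)[OF A B(1)] B(2) by (rule order_trans)
  qed
qed

text \<open>Almost additivity at \<open>y n + (x n - y n)\<close> bounds the distance of the images
  by the distance of the arguments plus \<open>e n\<close> times a bounded quantity. Both vanish
  along \<open>U\<close> for equivalent sequences.\<close>

lemma ultra_map_class:
  assumes x: "x \<in> bounded_sequences X"
  shows "ultra_map X U A (ultra_rel X U `` {x}) = ultra_rel X U `` {\<lambda>n. A n (x n)}"
proof -
  define y where "y = (SOME y. y \<in> ultra_rel X U `` {x})"
  have "y \<in> ultra_rel X U `` {x}"
    unfolding y_def some_in_eq using equiv_class_self[OF equiv_ultra_rel x] by blast
  then have y: "y \<in> bounded_sequences X" and xy: "((\<lambda>n. norm (x n - y n)) \<longlongrightarrow> 0) U"
    by (auto simp: ultra_rel_def)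
  obtain B where B: "\<And>n. y n \<in> X" "\<And>n. norm (y n) \<le> B" using bounded_sequencesE[OF y] by metis
  have xX: "x n \<in> X" for n using bounded_sequencesE[OF x] by metis
  have "ultra_rel X U `` {\<lambda>n. A n (x n)} = ultra_rel X U `` {\<lambda>n. A n (y n)}"
  proof (rule ultra_class_eqI)
    fix n
    have d: "x n - y n \<in> X" by (rule closed_subspaceD(4)[OF X xX B(1)])
    have "norm (A n (x n) - A n (y n)) \<le>
        norm (A n (y n + (x n - y n)) - (A n (y n) + A n (x n - y n))) + norm (A n (x n - y n))"
      using norm_triangle_ineq[of "A n (x n) - (A n (y n) + A n (x n - y n))" "A n (x n - y n)"]
      by simp
    also have "\<dots> \<le> e n * (norm (y n) + norm (x n - y n)) + norm (x n - y n)"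
      by (intro add_mono almost_linear_contractionD[OF A] B d)
    also have "\<dots> \<le> e n * (B + norm (x n - y n)) + norm (x n - y n)"
      using e(1) B(2) by (intro add_right_mono mult_left_mono) auto
    finally show "norm (A n (x n) - A n (y n)) \<le> e n * (B + norm (x n - y n)) + norm (x n - y n)" .
  next
    have "((\<lambda>n. e n * (B + norm (x n - y n)) + norm (x n - y n)) \<longlongrightarrow> 0 * (B + 0) + 0) U"
      by (intro tendsto_intros e(2) xy)
    then show "((\<lambda>n. e n * (B + norm (x n - y n)) + norm (x n - y n)) \<longlongrightarrow> 0) U" by simp
  qed (intro bounded_sequences_almost_linear x y)+
  then show ?thesis by (simp only: ultra_map_def flip: y_def)
qed

lemma vnorm_ultra_map_le:
  assumes x: "x \<in> bounded_sequences X"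
  shows "vnorm (ultrapower smul X U) (ultra_map X U A (ultra_rel X U `` {x}))
    \<le> vnorm (ultrapower smul X U) (ultra_rel X U `` {x})"
proof -
  have ne: "U \<noteq> bot" using U by (simp add: free_ultrafilter_def)
  have "norm (A n (x n)) \<le> norm (x n)" for n
    using almost_linear_contractionD(2)[OF A] bounded_sequencesE[OF x] by metis
  then show ?thesis
    unfolding ultra_map_class[OF x] vnorm_ultrapower[OF U x]
      vnorm_ultrapower[OF U bounded_sequences_almost_linear[OF x]]
    by (intro tendsto_le[OF ne tendsto_norm_bounded_sequence[OF U x]
          tendsto_norm_bounded_sequence[OF U bounded_sequences_almost_linear[OF x]]]) simp
qed

text \<open>On bounded representatives the defects of linearity are at most \<open>e n\<close> times
  a constant, so they vanish in the quotient and linearity becomes exact.\<close>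

lemma ultra_map_bounded_operator:
  "ultra_map X U A \<in> bounded_operators (ultrapower smul X U) (ultrapower smul X U)"
  unfolding bounded_operators_def mem_Collect_eq
proof (intro conjI ballI allI exI[of _ 1])
  fix C assume "C \<in> vcarrier (ultrapower smul X U)"
  then obtain x where x: "x \<in> bounded_sequences X" and C: "C = ultra_rel X U `` {x}"
    by (rule ultrapower_cases)
  obtain B where B: "\<And>n. x n \<in> X" "\<And>n. norm (x n) \<le> B" using bounded_sequencesE[OF x] by metis
  note Ax = bounded_sequences_almost_linear[OF x]
  show "ultra_map X U A C \<in> vcarrier (ultrapower smul X U)"
    unfolding C ultra_map_class[OF x] by (rule class_in_ultrapower[OF Ax])
  show "vnorm (ultrapower smul X U) (ultra_map X U A C) \<le> 1 * vnorm (ultrapower smul X U) C"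
    using vnorm_ultra_map_le[OF x] C by simp
  show "ultra_map X U A (vscale (ultrapower smul X U) c C) =
      vscale (ultrapower smul X U) c (ultra_map X U A C)" for c
    unfolding C vscale_ultrapower[OF banach_space_over_axioms X x] ultra_map_class[OF x]
      vscale_ultrapower[OF banach_space_over_axioms X Ax]
      ultra_map_class[OF bounded_sequences_scale[OF X x]]
  proof (rule ultra_class_eqI)
    fix n
    have "norm (A n (smul c (x n)) - smul c (A n (x n))) \<le> e n * (norm c * norm (x n))"
      by (rule almost_linear_contractionD(4)[OF A B(1)])
    also have "\<dots> \<le> e n * (norm c * B)" using e(1) B(2) by (intro mult_left_mono) auto
    finally show "norm (A n (smul c (x n)) - smul c (A n (x n))) \<le> e n * (norm c * B)" .
  next
    show "((\<lambda>n. e n * (norm c * B)) \<longlongrightarrow> 0) U" by (rule tendsto_mult_left_zero[OF e(2)])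
  qed (intro bounded_sequences_almost_linear bounded_sequences_scale X x)+
  fix D assume "D \<in> vcarrier (ultrapower smul X U)"
  then obtain y where y: "y \<in> bounded_sequences X" and D: "D = ultra_rel X U `` {y}"
    by (rule ultrapower_cases)
  obtain B' where B': "\<And>n. y n \<in> X" "\<And>n. norm (y n) \<le> B'" using bounded_sequencesE[OF y] by metis
  note Ay = bounded_sequences_almost_linear[OF y]
  have xy: "(\<lambda>n. x n + y n) \<in> bounded_sequences X"
    by (intro bounded_sequences_add x y closed_subspaceD(3)[OF X] B B')
  have AxAy: "(\<lambda>n. A n (x n) + A n (y n)) \<in> bounded_sequences X"
    by (intro bounded_sequences_add Ax Ay closed_subspaceD(3)[OF X]
        almost_linear_contractionD(1)[OF A] B B')
  show "ultra_map X U A (vadd (ultrapower smul X U) C D) =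
      vadd (ultrapower smul X U) (ultra_map X U A C) (ultra_map X U A D)"
    unfolding C D vadd_ultrapower[OF banach_space_over_axioms X x y] ultra_map_class[OF x]
      ultra_map_class[OF y] vadd_ultrapower[OF banach_space_over_axioms X Ax Ay]
      ultra_map_class[OF xy]
  proof (rule ultra_class_eqI)
    fix n
    have "norm (A n (x n + y n) - (A n (x n) + A n (y n))) \<le> e n * (norm (x n) + norm (y n))"
      by (rule almost_linear_contractionD(3)[OF A B(1) B'(1)])
    also have "\<dots> \<le> e n * (B + B')" using e(1) B(2) B'(2) by (intro mult_left_mono add_mono) auto
    finally show "norm (A n (x n + y n) - (A n (x n) + A n (y n))) \<le> e n * (B + B')" .
  next
    show "((\<lambda>n. e n * (B + B')) \<longlongrightarrow> 0) U" by (rule tendsto_mult_left_zero[OF e(2)])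
  qed (intro bounded_sequences_almost_linear xy AxAy)+
qed

text \<open>The upper bound is inherited from the contractions. For the lower bound, the almost
  maximising vectors form a bounded sequence whose class has an image of norm at least 1.\<close>

lemma operator_norm_ultra_map:
  assumes attain: "\<forall>\<^sub>F n in U. \<exists>x\<in>X. norm x \<le> 1 \<and> 1 - e n \<le> norm (A n x)"
  shows "operator_norm (ultrapower smul X U) (ultrapower smul X U) (ultra_map X U A) = 1"
proof (rule antisym)
  let ?E = "ultrapower smul X U"
  have ne: "U \<noteq> bot" using U by (simp add: free_ultrafilter_def)
  have "vnorm ?E (ultra_map X U A C) \<le> 1" if C: "C \<in> vcarrier ?E" "vnorm ?E C \<le> 1" for C
    using C(1)
  proof (rule ultrapower_cases)
    show ?thesis if "x \<in> bounded_sequences X" "C = ultra_rel X U `` {x}" for x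
      using vnorm_ultra_map_le[OF that(1)] that(2) C(2) by simp
  qed
  then show "operator_norm ?E ?E (ultra_map X U A) \<le> 1"
    unfolding operator_norm_def by (intro SUP_least) simp
  \<comment> \<open>The default 0 keeps the sequence in the unit ball of \<open>X\<close>; it occurs
    only off a set of \<open>U\<close>, so it does not affect the limits.\<close>
  define x where "x n = (if \<exists>x\<in>X. norm x \<le> 1 \<and> 1 - e n \<le> norm (A n x)
    then SOME x. x \<in> X \<and> norm x \<le> 1 \<and> 1 - e n \<le> norm (A n x) else 0)" for n
  have good: "x n \<in> X \<and> norm (x n) \<le> 1 \<and> 1 - e n \<le> norm (A n (x n))"
    if "\<exists>x\<in>X. norm x \<le> 1 \<and> 1 - e n \<le> norm (A n x)" for n
    using that someI_ex[of "\<lambda>x. x \<in> X \<and> norm x \<le> 1 \<and> 1 - e n \<le> norm (A n x)"]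
    unfolding x_def Bex_def by simp
  have x0: "x n \<in> X" "norm (x n) \<le> 1" for n
    using good[of n] X by (auto simp: x_def closed_subspace_def subspace_def)
  have x: "x \<in> bounded_sequences X" using x0 by (rule bounded_sequencesI)
  note Ax = bounded_sequences_almost_linear[OF x]
  have "vnorm ?E (ultra_rel X U `` {x}) \<le> 1"
    unfolding vnorm_ultrapower[OF U x]
    by (rule tendsto_upperbound[OF tendsto_norm_bounded_sequence[OF U x] _ ne]) (simp add: x0)
  moreover have "1 \<le> vnorm ?E (ultra_map X U A (ultra_rel X U `` {x}))"
    unfolding ultra_map_class[OF x] vnorm_ultrapower[OF U Ax]
  proof (rule tendsto_le[OF ne tendsto_norm_bounded_sequence[OF U Ax]])
    show "((\<lambda>n. 1 - e n) \<longlongrightarrow> 1) U" using tendsto_diff[OF tendsto_const e(2), of 1] by simp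
    show "\<forall>\<^sub>F n in U. 1 - e n \<le> norm (A n (x n))"
      using attain by eventually_elim (simp add: good)
  qed
  ultimately show "1 \<le> operator_norm ?E ?E (ultra_map X U A)"
    unfolding operator_norm_def
    by (intro SUP_upper2[of "ultra_rel X U `` {x}"]) (auto simp: class_in_ultrapower[OF x])
qed

text \<open>Of a functional in the dual sphere only linearity and the norm bound enter. Together
  with the limit of the perturbation inequality they give a scalar inequality in a parameter
  \<open>a\<close>, whose first-order part as \<open>a\<close> tends to 0 is the bound
  \<open>c\<close>.\<close>

lemma numerical_radius_ultra_map_le:
  assumes c: "0 \<le> c" and d: "(d \<longlongrightarrow> 0) U"
    and perturb: "\<forall>\<^sub>F n in U. \<forall>l. \<forall>x\<in>X. norm l * c \<le> 1 \<longrightarrow>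
      (1 - norm l * c) * norm (x + smul l (A n x)) \<le> (1 + (norm l)\<^sup>2 + (1 + norm l) * d n) * norm x"
  shows "numerical_radius (ultrapower smul X U) (ultra_map X U A) \<le> ennreal c"
  unfolding numerical_radius_def
proof (rule SUP_least, clarify)
  let ?E = "ultrapower smul X U" and ?T = "ultra_map X U A"
  have ne: "U \<noteq> bot" using U by (simp add: free_ultrafilter_def)
  fix C f assume C: "C \<in> unit_sphere ?E" and f: "f \<in> dual_sphere ?E" and fC: "f C = 1"
  obtain x where x: "x \<in> bounded_sequences X" and Cx: "C = ultra_rel X U `` {x}"
    using C by (auto simp: unit_sphere_def elim: ultrapower_cases)
  note Ax = bounded_sequences_almost_linear[OF x]
  have lim_x: "((\<lambda>n. norm (x n)) \<longlongrightarrow> 1) U"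
    using tendsto_norm_bounded_sequence[OF U x] C vnorm_ultrapower[OF U x, of smul]
    by (simp add: unit_sphere_def Cx)
  have xX: "x n \<in> X" for n using bounded_sequencesE[OF x] by metis
  \<comment> \<open>With this rotation in the perturbation parameter, the functional takes the value
    \<open>1 + a * norm (f (?T C))\<close> without loss.\<close>
  obtain w where w: "norm w = 1" "w * f (?T C) = of_real (norm (f (?T C)))"
    using rotate_to_norm .
  have key: "(1 - a * c) * (1 + a * norm (f (?T C))) \<le> 1 + a\<^sup>2" if a: "0 \<le> a" "a * c \<le> 1" for a
  proof -
    define l where "l = of_real a * w"
    have nl: "norm l = a" using a w by (simp add: l_def norm_mult)
    note lAx = bounded_sequences_scale[OF X Ax, of l]
    have y: "(\<lambda>n. x n + smul l (A n (x n))) \<in> bounded_sequences X" (is "?y \<in> _")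
      by (intro bounded_sequences_add x lAx closed_subspaceD(1,3)[OF X]
          almost_linear_contractionD(1)[OF A] xX)
    have TC: "?T C = ultra_rel X U `` {\<lambda>n. A n (x n)}" unfolding Cx by (rule ultra_map_class[OF x])
    have "vadd ?E C (vscale ?E l (?T C)) = ultra_rel X U `` {?y}"
      unfolding TC vscale_ultrapower[OF banach_space_over_axioms X Ax]
      unfolding Cx by (rule vadd_ultrapower[OF banach_space_over_axioms X x lAx])
    moreover have "f (vadd ?E C (vscale ?E l (?T C))) = f C + l * f (?T C)"
    proof -
      have "vscale ?E l (?T C) \<in> vcarrier ?E" "?T C \<in> vcarrier ?E" "C \<in> vcarrier ?E"
        unfolding TC vscale_ultrapower[OF banach_space_over_axioms X Ax]
        by (intro class_in_ultrapower Ax lAx, intro class_in_ultrapower Ax,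
            use C in \<open>simp add: unit_sphere_def\<close>)
      then show ?thesis
        using f by (auto simp: dual_sphere_def bounded_operators_def scalar_space_def)
    qed
    moreover have "l * f (?T C) = of_real (a * norm (f (?T C)))"
      using w by (simp add: l_def mult.assoc)
    ultimately have "f (ultra_rel X U `` {?y}) = of_real (1 + a * norm (f (?T C)))"
      by (simp add: fC)
    then have "1 + a * norm (f (?T C)) = norm (f (ultra_rel X U `` {?y}))"
      using a by (simp only: norm_of_real) simp
    also have "\<dots> \<le> Lim U (\<lambda>n. norm (?y n))"
      using dual_sphereD[OF homogeneous_norm_ultrapower[OF U X] f class_in_ultrapower[OF y]]
      by (simp add: vnorm_ultrapower[OF U y])
    finally have 1: "1 + a * norm (f (?T C)) \<le> Lim U (\<lambda>n. norm (?y n))" .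
    have "(1 - a * c) * Lim U (\<lambda>n. norm (?y n)) \<le> (1 + a\<^sup>2 + (1 + a) * 0) * 1"
    proof (rule tendsto_le[OF ne])
      show "((\<lambda>n. (1 - a * c) * norm (?y n)) \<longlongrightarrow> (1 - a * c) * Lim U (\<lambda>n. norm (?y n))) U"
        by (intro tendsto_intros tendsto_norm_bounded_sequence[OF U y])
      show "((\<lambda>n. (1 + a\<^sup>2 + (1 + a) * d n) * norm (x n)) \<longlongrightarrow> (1 + a\<^sup>2 + (1 + a) * 0) * 1) U"
        by (intro tendsto_intros d lim_x)
      show "\<forall>\<^sub>F n in U. (1 - a * c) * norm (?y n) \<le> (1 + a\<^sup>2 + (1 + a) * d n) * norm (x n)"
        using perturb by eventually_elim (use a(2) nl xX in force)
    qed
    then show ?thesis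
      using mult_left_mono[OF 1, of "1 - a * c"] a by simp
  qed
  define N where "N = norm (f (?T C))"
  \<comment> \<open>The constant 1 cancels from both sides of \<open>key\<close>, and what remains
    is divisible by \<open>a\<close>.\<close>
  have "(1 - a * c) * N \<le> c + a" if "0 < a" "a * c \<le> 1" for a
  proof -
    have "a * ((1 - a * c) * N) \<le> a * (c + a)"
      using key[of a] that by (simp add: N_def algebra_simps power2_eq_square)
    then show ?thesis using that by simp
  qed
  then have "\<forall>\<^sub>F a in at_right 0. (1 - a * c) * N \<le> c + a"
  proof -
    have "((\<lambda>a. a * c) \<longlongrightarrow> 0 * c) (at_right 0)" by (intro tendsto_intros)
    then have "\<forall>\<^sub>F a in at_right 0. a * c < 1" by (rule order_tendstoD) simp
    with eventually_at_right_less[of 0] show ?thesis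
      by eventually_elim (simp add: \<open>\<And>a. 0 < a \<Longrightarrow> a * c \<le> 1 \<Longrightarrow> (1 - a * c) * N \<le> c + a\<close>)
  qed
  moreover have "((\<lambda>a. (1 - a * c) * N) \<longlongrightarrow> (1 - 0 * c) * N) (at_right 0)"
    "((\<lambda>a. c + a) \<longlongrightarrow> c + 0) (at_right 0)"
    by (intro tendsto_intros)+
  ultimately have "(1 - 0 * c) * N \<le> c + 0"
    by (intro tendsto_le[OF trivial_limit_at_right_real])
  then show "ennreal (norm (f (?T C))) \<le> ennreal c" by (simp add: N_def ennreal_leI)
qed

end

end

section \<open>Free ultrafilters\<close>

text \<open>Freeness excludes each single index, hence each finite initial segment. Ordinary limits
  thus become limits along \<open>U\<close>.\<close>

lemma free_ultrafilter_le_sequentially: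
  assumes "free_ultrafilter U" shows "U \<le> sequentially"
proof (rule filter_leI)
  fix P :: "nat \<Rightarrow> bool" assume "eventually P sequentially"
  then obtain N where N: "\<And>n. n \<ge> N \<Longrightarrow> P n" by (auto simp: eventually_sequentially)
  have ne: "\<forall>\<^sub>F n in U. n \<noteq> m" for m
    using assms by (auto simp: free_ultrafilter_def)
  have "\<forall>\<^sub>F n in U. \<forall>m\<in>{..<N}. n \<noteq> m"
    using ne by (intro eventually_ball_finite) auto
  then show "eventually P U"
  proof eventually_elim
    case (elim n)
    then have "\<not> n < N" by blast
    then show ?case by (intro N) simp
  qed
qed

text \<open>Zorn's lemma yields a minimal proper filter below \<open>F\<close>. Restricting it to
  the set where \<open>P\<close> holds gives either \<open>bot\<close> or the same filter, so every
  \<open>P\<close> is decided.\<close>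

lemma ultrafilter_below:
  fixes F :: "'a filter"
  assumes "F \<noteq> bot"
  obtains U where "U \<le> F" "U \<noteq> bot" "\<And>P. eventually P U \<or> eventually (\<lambda>n. \<not> P n) U"
proof -
  define A where "A = {G. G \<le> F \<and> G \<noteq> bot}"
  have po: "partial_order_on A (relation_of (\<ge>) A)"
    by (rule partial_order_on_relation_ofI) simp_all
  have "\<exists>m\<in>A. \<forall>a\<in>A. m \<ge> a \<longrightarrow> a = m"
  proof (rule predicate_Zorn[OF po])
    fix C assume C: "C \<in> Chains (relation_of (\<ge>) A)"
    then have tot: "G \<le> H \<or> H \<le> G" if "G \<in> C" "H \<in> C" for G H
      using that by (auto simp: Chains_def relation_of_def)
    have CA: "C \<subseteq> A" using C by (auto simp: Chains_def relation_of_def)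
    show "\<exists>u\<in>A. \<forall>a\<in>C. a \<ge> u"
    proof (cases "C = {}")
      case True
      then show ?thesis using assms by (auto simp: A_def)
    next
      case False
      \<comment> \<open>A chain is a filter base: \<open>False\<close> would hold eventually for the
        infimum only if it did for a member.\<close>
      have "eventually P (Inf C) \<longleftrightarrow> (\<exists>b\<in>C. eventually P b)" for P
      proof (rule eventually_Inf_base[OF False])
        show "\<exists>x\<in>C. x \<le> inf G H" if "G \<in> C" "H \<in> C" for G H
          using tot[OF that] that by (metis inf.absorb1 inf.absorb2 order_refl)
      qed
      then have "Inf C \<noteq> bot"
        using CA by (auto simp: trivial_limit_def A_def)
      moreover have "Inf C \<le> F"
      proof -
        from False obtain G where "G \<in> C" by blast
        then have "Inf C \<le> G" "G \<le> F" using CA by (auto simp: A_def intro: Inf_lower)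
        then show ?thesis by (rule order_trans)
      qed
      ultimately have "Inf C \<in> A" by (simp add: A_def)
      then show ?thesis by (intro bexI[of _ "Inf C"] ballI Inf_lower)
    qed
  qed
  then obtain U where U: "U \<le> F" "U \<noteq> bot" and min: "\<And>G. G \<le> U \<Longrightarrow> G \<noteq> bot \<Longrightarrow> G = U"
    unfolding A_def by (metis (mono_tags, lifting) mem_Collect_eq order_trans)
  show thesis
  proof (rule that[OF U])
    fix P
    show "eventually P U \<or> eventually (\<lambda>n. \<not> P n) U"
    proof (cases "inf U (principal {n. P n}) = bot")
      case True
      then show ?thesis by (auto simp: trivial_limit_def eventually_inf_principal)
    next
      case False
      then have "inf U (principal {n. P n}) = U" by (intro min) auto
      moreover have "eventually P (inf U (principal {n. P n}))"
        by (simp add: eventually_inf_principal)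
      ultimately show ?thesis by simp
    qed
  qed
qed

text \<open>\<open>sequentially\<close> restricted to \<open>P\<close> is proper, so it has an
  ultrafilter below it. This one is free because it contains every final segment.\<close>

lemma free_ultrafilter_frequently:
  assumes "\<exists>\<^sub>F n in sequentially. P n"
  obtains U where "free_ultrafilter U" "eventually P U"
proof -
  let ?F = "inf sequentially (principal {n. P n})"
  have "?F \<noteq> bot"
    using assms by (simp add: trivial_limit_def eventually_inf_principal frequently_def)
  then obtain U where U: "U \<le> ?F" "U \<noteq> bot" "\<And>P. eventually P U \<or> eventually (\<lambda>n. \<not> P n) U"
    using ultrafilter_below by blast
  have "\<not> eventually (\<lambda>n. n = m) U" for m
  proof
    assume "eventually (\<lambda>n. n = m) U"
    moreover have "eventually (\<lambda>n. m < n) ?F"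
      unfolding eventually_inf_principal using eventually_gt_at_top[of m] by eventually_elim simp
    then have "eventually (\<lambda>n. m < n) U" by (rule filter_leD[OF U(1)])
    ultimately have "eventually (\<lambda>n. False) U" by eventually_elim simp
    then show False using U(2) by (simp add: trivial_limit_def)
  qed
  moreover have "eventually P U"
    by (rule filter_leD[OF U(1)]) (simp add: eventually_inf_principal)
  ultimately show thesis using U by (intro that) (auto simp: free_ultrafilter_def)
qed

section \<open>The numerical index of the limit\<close>

context banach_space_over
begin

text \<open>The operators transferred from \<open>X n\<close> for \<open>U\<close>-many
  \<open>n\<close> induce a single operator on the ultrapower, of norm 1 and numerical radius at
  most \<open>c\<close>; it competes in the infimum defining the index.\<close>

lemma numerical_index_ultrapower_le:
  assumes X: "\<And>n. closed_subspace smul (X n)" and X\<^sub>0: "closed_subspace smul X\<^sub>0"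
    and gap: "(\<lambda>n. gap (X n) X\<^sub>0) \<longlonglongrightarrow> 0" and U: "free_ultrafilter U"
    and index: "\<forall>\<^sub>F n in U. numerical_index (subspace_nspace smul (X n)) < ennreal c" and c: "0 \<le> c"
  shows "numerical_index (ultrapower smul X\<^sub>0 U) \<le> ennreal c"
proof -
  have Useq: "U \<le> sequentially" by (rule free_ultrafilter_le_sequentially[OF U])
  \<comment> \<open>The transfer asks for a bound strictly above the gap, whence the extra term
    tending to 0. Since \<open>enn2real\<close> sends an infinite gap to 0, strictness is claimed
    only for finite gaps.\<close>
  define d where "d n = enn2real (gap (X n) X\<^sub>0) + 1 / real (Suc n)" for n
  have "(\<lambda>n. enn2real (gap (X n) X\<^sub>0)) \<longlonglongrightarrow> 0"
    using gap by (intro tendsto_enn2real) auto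
  then have "d \<longlonglongrightarrow> 0 + 0"
    unfolding d_def by (intro tendsto_add LIMSEQ_inverse_real_of_nat[unfolded inverse_eq_divide])
  then have d: "(d \<longlongrightarrow> 0) U" using tendsto_mono[OF Useq] by simp
  have d0: "0 \<le> d n" for n by (simp add: d_def)
  have less: "gap (X n) X\<^sub>0 < ennreal (d n)" if "gap (X n) X\<^sub>0 < top" for n
  proof -
    have "gap (X n) X\<^sub>0 = ennreal (enn2real (gap (X n) X\<^sub>0))" using that by simp
    also have "\<dots> < ennreal (d n)" by (intro ennreal_lessI) (simp_all add: d_def add_nonneg_pos)
    finally show ?thesis .
  qed
  have "\<forall>\<^sub>F n in U. gap (X n) X\<^sub>0 < top"
    using tendsto_mono[OF Useq gap] by (rule order_tendstoD) simp
  define good where "good n \<longleftrightarrow>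
    gap (X n) X\<^sub>0 < top \<and> numerical_index (subspace_nspace smul (X n)) < ennreal c" for n
  have good: "\<forall>\<^sub>F n in U. good n"
    unfolding good_def by (intro eventually_conj index \<open>\<forall>\<^sub>F n in U. gap (X n) X\<^sub>0 < top\<close>)
  have "\<exists>A. almost_linear_contraction X\<^sub>0 (4 * d n) A \<and> (good n \<longrightarrow>
      (\<forall>l. \<forall>x\<in>X\<^sub>0. norm l * c \<le> 1 \<longrightarrow>
        (1 - norm l * c) * norm (x + smul l (A x)) \<le> (1 + (norm l)\<^sup>2 + (1 + norm l) * d n) * norm x) \<and>
      (\<exists>x\<in>X\<^sub>0. norm x \<le> 1 \<and> 1 - 3 * d n \<le> norm (A x)))" for n
  proof (cases "good n")
    case True
    then show ?thesis
      using gap_transfer_operator[OF X[of n] X\<^sub>0 less[of n] _ c] unfolding good_def by metis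
  next
    case False
    \<comment> \<open>At the remaining indices, which \<open>U\<close> ignores, the zero map fills
      the sequence.\<close>
    have "almost_linear_contraction X\<^sub>0 (4 * d n) (\<lambda>_. 0)"
      using X\<^sub>0 d0[of n]
      by (auto simp: almost_linear_contraction_def closed_subspace_def subspace_def)
    with False show ?thesis by blast
  qed
  then obtain A where A: "\<And>n. almost_linear_contraction X\<^sub>0 (4 * d n) (A n)"
    and perturb: "\<And>n l x. good n \<Longrightarrow> x \<in> X\<^sub>0 \<Longrightarrow> norm l * c \<le> 1 \<Longrightarrow>
      (1 - norm l * c) * norm (x + smul l (A n x)) \<le> (1 + (norm l)\<^sup>2 + (1 + norm l) * d n) * norm x"
    and attain: "\<And>n. good n \<Longrightarrow> \<exists>x\<in>X\<^sub>0. norm x \<le> 1 \<and> 1 - 3 * d n \<le> norm (A n x)"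
    by metis
  have e: "0 \<le> 4 * d n" for n using d0 by simp
  have e_lim: "((\<lambda>n. 4 * d n) \<longlongrightarrow> 0) U" using tendsto_mult_right_zero[OF d] .
  let ?E = "ultrapower smul X\<^sub>0 U" and ?T = "ultra_map X\<^sub>0 U A"
  have "?T \<in> bounded_operators ?E ?E"
    by (rule ultra_map_bounded_operator[OF X\<^sub>0 U A e e_lim])
  moreover have "operator_norm ?E ?E ?T = 1"
  proof (rule operator_norm_ultra_map[OF X\<^sub>0 U A e e_lim])
    \<comment> \<open>One error sequence serves for both linearity and norm, so the shortfall
      \<open>3 * d n\<close> is relaxed to \<open>4 * d n\<close>.\<close>
    show "\<forall>\<^sub>F n in U. \<exists>x\<in>X\<^sub>0. norm x \<le> 1 \<and> 1 - 4 * d n \<le> norm (A n x)"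
      using good
    proof eventually_elim
      case (elim n)
      then obtain x where "x \<in> X\<^sub>0" "norm x \<le> 1" "1 - 3 * d n \<le> norm (A n x)"
        using attain by blast
      then show ?case using d0[of n] by (intro bexI[of _ x]) auto
    qed
  qed
  moreover have "numerical_radius ?E ?T \<le> ennreal c"
    by (rule numerical_radius_ultra_map_le[OF X\<^sub>0 U A e e_lim c d])
      (use good in eventually_elim, use perturb in blast)
  ultimately show ?thesis
    unfolding numerical_index_def by (intro INF_lower2[of ?T]) auto
qed

end

theorem theoremC:
  fixes smul :: "'k::real_or_complex \<Rightarrow> 'a::banach \<Rightarrow> 'a"
    and X :: "nat \<Rightarrow> 'a set" and X\<^sub>0 :: "'a set"
  assumes "banach_space_over smul"
    and "\<And>n. closed_subspace smul (X n)"
    and "closed_subspace smul X\<^sub>0"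
    and "(\<lambda>n. gap (X n) X\<^sub>0) \<longlonglongrightarrow> 0"
  shows "(\<forall>U. free_ultrafilter U \<longrightarrow>
            numerical_index (ultrapower smul X\<^sub>0 U)
              \<le> Lim U (\<lambda>n. numerical_index (subspace_nspace smul (X n)))) \<and>
         ((\<forall>U. free_ultrafilter U \<longrightarrow>
            numerical_index (ultrapower smul X\<^sub>0 U) = numerical_index (subspace_nspace smul X\<^sub>0)) \<longrightarrow>
          numerical_index (subspace_nspace smul X\<^sub>0)
            \<le> liminf (\<lambda>n. numerical_index (subspace_nspace smul (X n))))"
proof -
  interpret banach_space_over smul by fact
  let ?a = "\<lambda>n. numerical_index (subspace_nspace smul (X n))"
  have le_Lim: "numerical_index (ultrapower smul X\<^sub>0 U) \<le> Lim U ?a" if U: "free_ultrafilter U" for U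
  \<comment> \<open>A value \<open>z\<close> strictly above the limit makes the indices eventually
    smaller than \<open>z\<close> along \<open>U\<close>; for infinite \<open>z\<close> the bound is
    trivial.\<close>
  proof (rule dense_ge)
    fix z assume z: "Lim U ?a < z"
    show "numerical_index (ultrapower smul X\<^sub>0 U) \<le> z"
    proof (cases z rule: ennreal_cases)
      case (real c)
      have "\<forall>\<^sub>F n in U. ?a n < ennreal c"
        using free_ultrafilter_tendsto_Lim_ennreal[OF U, of ?a] z unfolding real(2)
        by (rule order_tendstoD)
      then show ?thesis
        unfolding real(2) by (rule numerical_index_ultrapower_le[OF assms(2-4) U _ real(1)])
    qed simp
  qed
  moreover have "numerical_index (subspace_nspace smul X\<^sub>0) \<le> liminf ?a"
    if eq: "\<And>U. free_ultrafilter U \<Longrightarrow>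
      numerical_index (ultrapower smul X\<^sub>0 U) = numerical_index (subspace_nspace smul X\<^sub>0)"
    unfolding le_Liminf_iff
  proof (intro allI impI, rule ccontr)
    fix y assume y: "y < numerical_index (subspace_nspace smul X\<^sub>0)"
      and "\<not> (\<forall>\<^sub>F n in sequentially. y < ?a n)"
    \<comment> \<open>Values at most \<open>y\<close> recur infinitely often, and a free ultrafilter
      can concentrate on them; its limit is then at most \<open>y\<close>, below the index of
      \<open>X\<^sub>0\<close>.\<close>
    then have "\<exists>\<^sub>F n in sequentially. ?a n \<le> y"
      by (simp add: frequently_def not_le)
    then obtain U where U: "free_ultrafilter U" "\<forall>\<^sub>F n in U. ?a n \<le> y"
      by (rule free_ultrafilter_frequently)
    have "Lim U ?a \<le> y"
      using free_ultrafilter_tendsto_Lim_ennreal[OF U(1)] U(2)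
      by (rule tendsto_upperbound) (use U(1) in \<open>simp add: free_ultrafilter_def\<close>)
    with le_Lim[OF U(1)] eq[OF U(1)] y show False by simp
  qed
  ultimately show ?thesis by blast
qed

end
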